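(* Let $\mathbf{M}$ be a non-trivial finite semilinear idempotent distributive $\ell$-monoid. Then the following are equivalent: (1) $\mathbf{M}$ is subdirectly irreducible. (2) $\mathbf{M}\cong\boxplus_{i=1}^{n}\mathbf{M}_i$ for some $n\in\mathbb{N}\setminus\{0\}$ with $\mathbf{M}_i\in\{\mathbf{C}_2,\mathbf{C}_2^\partial,\mathbf{G}_3,\mathbf{D}_3\}$ such that for every $i\in\{1,\dots,n-1\}$, if $\mathbf{M}_i=\mathbf{M}_{i+1}$, then $\mathbf{M}_i\in\{\mathbf{G}_3,\mathbf{D}_3\}$. (3) The congruence lattice of $\mathbf{M}$ is a chain.
   Context: A distributive $\ell$-monoid is an algebra $\mathbf{M}=\langle M,\wedge,\vee,\cdot,e\rangle$ such that $\langle M,\wedge,\vee\rangle$ is a distributive lattice, $\langle M,\cdot,e\rangle$ is a monoid, and $a(b\vee c)d=abd\vee acd$, $a(b\wedge c)d=abd\wedge acd$ for all $a,b,c,d\in M$. It is idempotent if $a\cdot a=a$ for all $a$. An ordered monoid is a distributive $\ell$-monoid whose lattice order is total (equivalently, a monoid with a compatible total order). A distributive $\ell$-monoid is semilinear if it belongs to the variety generated by the class of ordered monoids. The four algebras are the following idempotent ordered monoids with identity $e$: $\mathbf{C}_2$ has universe $\{\bot<e\}$; $\mathbf{C}_2^\partial$ has universe $\{e<\top\}$; $\mathbf{G}_3$ has universe $\{\bot<e<\top\}$ with $\bot\cdot\top=\bot$, $\top\cdot\bot=\top$; $\mathbf{D}_3$ has universe $\{\bot<e<\top\}$ with $\bot\cdot\top=\top$,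 $\top\cdot\bot=\bot$. Nested sum: for idempotent ordered monoids $\mathbf{M},\mathbf{N}$, relabeled so that $M\cap N=\{e\}$, $\mathbf{M}\boxplus\mathbf{N}$ has universe $M\cup N$ and identity $e$; its product extends the products of $\mathbf{M}$ and $\mathbf{N}$, with $a\cdot b=b\cdot a=a$ for all $a\in M\setminus\{e\}$, $b\in N$; its order is the least extension of the orders of $\mathbf{M}$ and $\mathbf{N}$ such that for all $a\in M\setminus\{e\}$ and $b\in N$: $a\le b$ if $a\le_{\mathbf{M}}e$, and $b\le a$ if $e\le_{\mathbf{M}}a$. This operation is associative up to isomorphism, and $\boxplus_{i=1}^n\mathbf{M}_i=\mathbf{M}_1\boxplus\cdots\boxplus\mathbf{M}_n$. Equalities $\mathbf{M}_i=\mathbf{M}_{i+1}$ are equalities of members of $\{\mathbf{C}_2,\mathbf{C}_2^\partial,\mathbf{G}_3,\mathbf{D}_3\}$ (before relabeling). *)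

theory Defs
  imports "HOL-Algebra.Group" "HOL-Library.Countable_Set"
begin

record 'a lmonoid = "'a monoid" +
  lmeet :: "'a \<Rightarrow> 'a \<Rightarrow> 'a" (infixl \<open>\<curlywedge>\<index>\<close> 65)
  ljoin :: "'a \<Rightarrow> 'a \<Rightarrow> 'a" (infixl \<open>\<curlyvee>\<index>\<close> 65)

locale distributive_lmonoid = monoid M
  for M :: "'a lmonoid" (structure) +
  assumes meet_closed: "\<lbrakk>x \<in> carrier M; y \<in> carrier M\<rbrakk> \<Longrightarrow> x \<curlywedge> y \<in> carrier M"
    and join_closed: "\<lbrakk>x \<in> carrier M; y \<in> carrier M\<rbrakk> \<Longrightarrow> x \<curlyvee> y \<in> carrier M"
    and meet_comm: "\<lbrakk>x \<in> carrier M; y \<in> carrier M\<rbrakk> \<Longrightarrow> x \<curlywedge> y = y \<curlywedge> x"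
    and join_comm: "\<lbrakk>x \<in> carrier M; y \<in> carrier M\<rbrakk> \<Longrightarrow> x \<curlyvee> y = y \<curlyvee> x"
    and meet_assoc: "\<lbrakk>x \<in> carrier M; y \<in> carrier M; z \<in> carrier M\<rbrakk>
      \<Longrightarrow> (x \<curlywedge> y) \<curlywedge> z = x \<curlywedge> (y \<curlywedge> z)"
    and join_assoc: "\<lbrakk>x \<in> carrier M; y \<in> carrier M; z \<in> carrier M\<rbrakk>
      \<Longrightarrow> (x \<curlyvee> y) \<curlyvee> z = x \<curlyvee> (y \<curlyvee> z)"
    and meet_absorb: "\<lbrakk>x \<in> carrier M; y \<in> carrier M\<rbrakk> \<Longrightarrow> x \<curlywedge> (x \<curlyvee> y) = x"
    and join_absorb: "\<lbrakk>x \<in> carrier M; y \<in> carrier M\<rbrakk> \<Longrightarrow> x \<curlyvee> (x \<curlywedge> y) = x"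
    and meet_join_distrib: "\<lbrakk>x \<in> carrier M; y \<in> carrier M; z \<in> carrier M\<rbrakk>
      \<Longrightarrow> x \<curlywedge> (y \<curlyvee> z) = (x \<curlywedge> y) \<curlyvee> (x \<curlywedge> z)"
    and mult_join: "\<lbrakk>a \<in> carrier M; b \<in> carrier M; c \<in> carrier M; d \<in> carrier M\<rbrakk>
      \<Longrightarrow> a \<otimes> (b \<curlyvee> c) \<otimes> d = (a \<otimes> b \<otimes> d) \<curlyvee> (a \<otimes> c \<otimes> d)"
    and mult_meet: "\<lbrakk>a \<in> carrier M; b \<in> carrier M; c \<in> carrier M; d \<in> carrier M\<rbrakk>
      \<Longrightarrow> a \<otimes> (b \<curlywedge> c) \<otimes> d = (a \<otimes> b \<otimes> d) \<curlywedge> (a \<otimes> c \<otimes> d)"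

definition lm_le :: "'a lmonoid \<Rightarrow> 'a \<Rightarrow> 'a \<Rightarrow> bool" where
  "lm_le M x y \<longleftrightarrow> x \<curlywedge>\<^bsub>M\<^esub> y = x"

definition idempotent_lm :: "'a lmonoid \<Rightarrow> bool" where
  "idempotent_lm M \<longleftrightarrow> (\<forall>a\<in>carrier M. a \<otimes>\<^bsub>M\<^esub> a = a)"

definition ordered_monoid :: "'a lmonoid \<Rightarrow> bool" where
  "ordered_monoid M \<longleftrightarrow> distributive_lmonoid M \<and>
     (\<forall>x\<in>carrier M. \<forall>y\<in>carrier M. lm_le M x y \<or> lm_le M y x)"

definition lm_hom :: "'a lmonoid \<Rightarrow> 'b lmonoid \<Rightarrow> ('a \<Rightarrow> 'b) set" where
  "lm_hom M N = {h \<in> hom M N. h \<one>\<^bsub>M\<^esub> = \<one>\<^bsub>N\<^esub> \<and>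
     (\<forall>x\<in>carrier M. \<forall>y\<in>carrier M.
        h (x \<curlywedge>\<^bsub>M\<^esub> y) = h x \<curlywedge>\<^bsub>N\<^esub> h y \<and> h (x \<curlyvee>\<^bsub>M\<^esub> y) = h x \<curlyvee>\<^bsub>N\<^esub> h y)}"

definition lm_iso :: "'a lmonoid \<Rightarrow> 'b lmonoid \<Rightarrow> ('a \<Rightarrow> 'b) set" where
  "lm_iso M N = {h \<in> lm_hom M N. bij_betw h (carrier M) (carrier N)}"

definition lm_isomorphic :: "'a lmonoid \<Rightarrow> 'b lmonoid \<Rightarrow> bool" where
  "lm_isomorphic M N \<longleftrightarrow> lm_iso M N \<noteq> {}"

text \<open>Transport of structure along a map that is injective on the carrier.\<close>

definition lm_image :: "('a \<Rightarrow> 'b) \<Rightarrow> 'a lmonoid \<Rightarrow> 'b lmonoid" where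
  "lm_image h M = (let g = inv_into (carrier M) h in
     \<lparr>carrier = h ` carrier M,
      mult = (\<lambda>x y. h (g x \<otimes>\<^bsub>M\<^esub> g y)),
      one = h \<one>\<^bsub>M\<^esub>,
      lmeet = (\<lambda>x y. h (g x \<curlywedge>\<^bsub>M\<^esub> g y)),
      ljoin = (\<lambda>x y. h (g x \<curlyvee>\<^bsub>M\<^esub> g y))\<rparr>)"

lemma lm_image_simps:
  assumes "inj_on h (carrier M)"
  shows "carrier (lm_image h M) = h ` carrier M"
    and "\<one>\<^bsub>lm_image h M\<^esub> = h \<one>\<^bsub>M\<^esub>"
    and "\<lbrakk>x \<in> carrier M; y \<in> carrier M\<rbrakk> \<Longrightarrow> h x \<otimes>\<^bsub>lm_image h M\<^esub> h y = h (x \<otimes>\<^bsub>M\<^esub> y)"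
    and "\<lbrakk>x \<in> carrier M; y \<in> carrier M\<rbrakk> \<Longrightarrow> h x \<curlywedge>\<^bsub>lm_image h M\<^esub> h y = h (x \<curlywedge>\<^bsub>M\<^esub> y)"
    and "\<lbrakk>x \<in> carrier M; y \<in> carrier M\<rbrakk> \<Longrightarrow> h x \<curlyvee>\<^bsub>lm_image h M\<^esub> h y = h (x \<curlyvee>\<^bsub>M\<^esub> y)"
  using assms by (simp_all add: lm_image_def Let_def)

lemma distributive_lmonoid_image:
  assumes "distributive_lmonoid M" "inj_on h (carrier M)"
  shows "distributive_lmonoid (lm_image h M)"
proof -
  interpret distributive_lmonoid M by fact
  note cl = meet_closed join_closed
  note sm = lm_image_simps[OF assms(2)]
  note axs = m_assoc meet_comm join_comm meet_assoc join_assoc meet_absorb join_absorb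
    meet_join_distrib mult_join mult_meet
  show ?thesis
    apply (unfold_locales; unfold sm(1,2); (elim imageE)?)
    apply (simp_all only: sm cl m_closed one_closed imageI l_one r_one)
    apply ((rule arg_cong[where f = h], rule axs; assumption)+)
    done
qed

lemma ordered_monoid_image:
  assumes "ordered_monoid M" "inj_on h (carrier M)"
  shows "ordered_monoid (lm_image h M)"
proof -
  have "distributive_lmonoid (lm_image h M)"
    using assms distributive_lmonoid_image by (auto simp: ordered_monoid_def)
  moreover have "lm_le (lm_image h M) x y \<or> lm_le (lm_image h M) y x"
    if "x \<in> carrier (lm_image h M)" "y \<in> carrier (lm_image h M)" for x y
  proof -
    note sm = lm_image_simps[OF assms(2)]
    obtain a b where ab: "a \<in> carrier M" "b \<in> carrier M" "x = h a" "y = h b"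
      using \<open>x \<in> _\<close> \<open>y \<in> _\<close> unfolding sm(1) by blast
    then have "a \<curlywedge>\<^bsub>M\<^esub> b = a \<or> b \<curlywedge>\<^bsub>M\<^esub> a = b"
      using assms(1) by (simp add: ordered_monoid_def lm_le_def)
    then show ?thesis using ab by (auto simp: lm_le_def sm)
  qed
  ultimately show ?thesis by (simp add: ordered_monoid_def)
qed

datatype lm_term =
  TVar nat | TOne | TMult lm_term lm_term | TMeet lm_term lm_term | TJoin lm_term lm_term

instance lm_term :: countable by countable_datatype

primrec lm_eval :: "'a lmonoid \<Rightarrow> (nat \<Rightarrow> 'a) \<Rightarrow> lm_term \<Rightarrow> 'a" where
  "lm_eval M v (TVar i) = v i"
| "lm_eval M v TOne = \<one>\<^bsub>M\<^esub>"
| "lm_eval M v (TMult s t) = lm_eval M v s \<otimes>\<^bsub>M\<^esub> lm_eval M v t"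
| "lm_eval M v (TMeet s t) = lm_eval M v s \<curlywedge>\<^bsub>M\<^esub> lm_eval M v t"
| "lm_eval M v (TJoin s t) = lm_eval M v s \<curlyvee>\<^bsub>M\<^esub> lm_eval M v t"

definition satisfies_eq :: "'a lmonoid \<Rightarrow> lm_term \<Rightarrow> lm_term \<Rightarrow> bool" where
  "satisfies_eq M s t \<longleftrightarrow> (\<forall>v. range v \<subseteq> carrier M \<longrightarrow> lm_eval M v s = lm_eval M v t)"

text \<open>The variety generated by a class is the class of models of the equations valid in that
  class. HOL cannot quantify over all types inside a definition; the lemma
  \<open>satisfies_eq_all_ordered_monoids\<close> below shows that ordered monoids with carrier in
  \<^typ>\<open>nat\<close> already determine the equations valid in all ordered monoids.\<close>

definition valid_in_ordered_monoids :: "lm_term \<Rightarrow> lm_term \<Rightarrow> bool" where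
  "valid_in_ordered_monoids s t \<longleftrightarrow>
     (\<forall>N :: nat lmonoid. ordered_monoid N \<longrightarrow> satisfies_eq N s t)"

definition semilinear :: "'a lmonoid \<Rightarrow> bool" where
  "semilinear M \<longleftrightarrow> distributive_lmonoid M \<and>
     (\<forall>s t. valid_in_ordered_monoids s t \<longrightarrow> satisfies_eq M s t)"

lemma lm_eval_closed:
  assumes "distributive_lmonoid M" "range v \<subseteq> carrier M"
  shows "lm_eval M v t \<in> carrier M"
proof -
  interpret distributive_lmonoid M by fact
  show ?thesis using assms(2) by (induction t) (auto intro: meet_closed join_closed)
qed

lemma satisfies_eq_all_ordered_monoids:
  fixes N :: "'b lmonoid"
  assumes "valid_in_ordered_monoids s t" "ordered_monoid N"
  shows "satisfies_eq N s t"
  unfolding satisfies_eq_def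
proof (intro allI impI)
  fix v :: "nat \<Rightarrow> 'b" assume v: "range v \<subseteq> carrier N"
  have N: "distributive_lmonoid N" using assms(2) by (simp add: ordered_monoid_def)
  interpret distributive_lmonoid N by (fact N)
  define S where "S = range (lm_eval N v)"
  define P where "P = N\<lparr>carrier := S\<rparr>"
  define h where "h = to_nat_on S"
  have SN: "S \<subseteq> carrier N" using lm_eval_closed[OF N v] by (auto simp: S_def)
  have SI: "lm_eval N v u \<in> S" for u by (simp add: S_def)
  have oneS: "\<one>\<^bsub>N\<^esub> \<in> S" using SI[of TOne] by simp
  have cl: "x \<otimes>\<^bsub>N\<^esub> y \<in> S" "x \<curlywedge>\<^bsub>N\<^esub> y \<in> S" "x \<curlyvee>\<^bsub>N\<^esub> y \<in> S"
    if xy: "x \<in> S" "y \<in> S" for x y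
  proof -
    obtain p q where "x = lm_eval N v p" "y = lm_eval N v q" using xy by (auto simp: S_def)
    then show "x \<otimes>\<^bsub>N\<^esub> y \<in> S" "x \<curlywedge>\<^bsub>N\<^esub> y \<in> S" "x \<curlyvee>\<^bsub>N\<^esub> y \<in> S"
      using SI[of "TMult p q"] SI[of "TMeet p q"] SI[of "TJoin p q"] by simp_all
  qed
  have "distributive_lmonoid P"
    unfolding P_def
    apply unfold_locales
    apply (simp_all add: cl oneS SN[THEN subsetD])
    apply (rule m_assoc meet_comm join_comm meet_assoc join_assoc meet_absorb join_absorb
       meet_join_distrib mult_join mult_meet; simp add: SN[THEN subsetD])+
    done
  then have P: "ordered_monoid P"
    using assms(2) by (simp add: ordered_monoid_def P_def lm_le_def SN[THEN subsetD])
  have "countable S" by (simp add: S_def)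
  then have inj: "inj_on h (carrier P)" by (simp add: h_def P_def inj_on_to_nat_on)
  have vS: "lm_eval N v u \<in> carrier P" for u by (simp add: P_def S_def)
  have ev: "lm_eval (lm_image h P) (h \<circ> v) u = h (lm_eval N v u)" for u
  proof (induction u)
  qed (simp_all add: lm_image_simps[OF inj] vS, simp_all add: P_def)
  have rng: "range (h \<circ> v) \<subseteq> carrier (lm_image h P)"
    using vS[of "TVar _"] by (auto simp: lm_image_simps[OF inj])
  have "satisfies_eq (lm_image h P) s t"
    using assms(1) ordered_monoid_image[OF P inj] by (simp add: valid_in_ordered_monoids_def)
  then have "h (lm_eval N v s) = h (lm_eval N v t)"
    using rng ev by (metis satisfies_eq_def)
  then show "lm_eval N v s = lm_eval N v t"
    using inj vS by (auto dest: inj_onD)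
qed

definition congruences :: "'a lmonoid \<Rightarrow> ('a \<times> 'a) set set" where
  "congruences M = {\<theta>. equiv (carrier M) \<theta> \<and>
     (\<forall>(a, b)\<in>\<theta>. \<forall>(c, d)\<in>\<theta>.
        (a \<otimes>\<^bsub>M\<^esub> c, b \<otimes>\<^bsub>M\<^esub> d) \<in> \<theta> \<and>
        (a \<curlywedge>\<^bsub>M\<^esub> c, b \<curlywedge>\<^bsub>M\<^esub> d) \<in> \<theta> \<and>
        (a \<curlyvee>\<^bsub>M\<^esub> c, b \<curlyvee>\<^bsub>M\<^esub> d) \<in> \<theta>)}"

definition lm_product :: "'i set \<Rightarrow> ('i \<Rightarrow> 'b lmonoid) \<Rightarrow> ('i \<Rightarrow> 'b) lmonoid" where
  "lm_product I A =
     \<lparr>carrier = (\<Pi>\<^sub>E i\<in>I. carrier (A i)),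
      mult = (\<lambda>x y. \<lambda>i\<in>I. x i \<otimes>\<^bsub>A i\<^esub> y i),
      one = (\<lambda>i\<in>I. \<one>\<^bsub>A i\<^esub>),
      lmeet = (\<lambda>x y. \<lambda>i\<in>I. x i \<curlywedge>\<^bsub>A i\<^esub> y i),
      ljoin = (\<lambda>x y. \<lambda>i\<in>I. x i \<curlyvee>\<^bsub>A i\<^esub> y i)\<rparr>"

definition subdirect_embedding ::
    "'a lmonoid \<Rightarrow> 'i set \<Rightarrow> ('i \<Rightarrow> 'b lmonoid) \<Rightarrow> ('a \<Rightarrow> 'i \<Rightarrow> 'b) \<Rightarrow> bool" where
  "subdirect_embedding M I A f \<longleftrightarrow>
     (\<forall>i\<in>I. distributive_lmonoid (A i)) \<and>
     f \<in> lm_hom M (lm_product I A) \<and> inj_on f (carrier M) \<and>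
     (\<forall>i\<in>I. (\<lambda>x. f x i) ` carrier M = carrier (A i))"

text \<open>Up to isomorphism the components of a subdirect representation of \<open>M\<close> are quotients of
  \<open>M\<close>, so it suffices to take components whose elements are subsets of \<open>M\<close>, indexed by
  relations on \<open>M\<close>. The lemma \<open>subdirectly_irreducible_all_types\<close> below extends the property
  to families over arbitrary types.\<close>

definition subdirectly_irreducible :: "'a lmonoid \<Rightarrow> bool" where
  "subdirectly_irreducible M \<longleftrightarrow>
     (\<forall>(I :: ('a \<times> 'a) set set) (A :: ('a \<times> 'a) set \<Rightarrow> 'a set lmonoid) f.
        subdirect_embedding M I A f \<longrightarrow> (\<exists>i\<in>I. (\<lambda>x. f x i) \<in> lm_iso M (A i)))"

lemma subdirectly_irreducible_all_types:
  fixes A :: "'i \<Rightarrow> 'b lmonoid" and M :: "'a lmonoid"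
  assumes si: "subdirectly_irreducible M" and M: "distributive_lmonoid M"
    and f: "subdirect_embedding M I A f"
  shows "\<exists>i\<in>I. (\<lambda>x. f x i) \<in> lm_iso M (A i)"
proof -
  interpret distributive_lmonoid M by fact
  have A: "distributive_lmonoid (A i)" if "i \<in> I" for i
    using f that by (simp add: subdirect_embedding_def)
  have surj: "(\<lambda>x. f x i) ` carrier M = carrier (A i)" if "i \<in> I" for i
    using f that by (simp add: subdirect_embedding_def)
  have fc: "f x \<in> (\<Pi>\<^sub>E i\<in>I. carrier (A i))" if "x \<in> carrier M" for x
    using f that by (auto simp: subdirect_embedding_def lm_hom_def hom_def lm_product_def)
  have fm: "f (x \<otimes>\<^bsub>M\<^esub> y) i = f x i \<otimes>\<^bsub>A i\<^esub> f y i" "f (x \<curlywedge>\<^bsub>M\<^esub> y) i = f x i \<curlywedge>\<^bsub>A i\<^esub> f y i"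
    "f (x \<curlyvee>\<^bsub>M\<^esub> y) i = f x i \<curlyvee>\<^bsub>A i\<^esub> f y i"
    if "x \<in> carrier M" "y \<in> carrier M" "i \<in> I" for x y i
    using f that by (auto simp: subdirect_embedding_def lm_hom_def hom_def lm_product_def)
  have f1: "f \<one>\<^bsub>M\<^esub> i = \<one>\<^bsub>A i\<^esub>" if "i \<in> I" for i
    using f that by (auto simp: subdirect_embedding_def lm_hom_def hom_def lm_product_def)
  define ker where "ker i = {(x, y). x \<in> carrier M \<and> y \<in> carrier M \<and> f x i = f y i}" for i
  define j where "j \<theta> = (SOME i. i \<in> I \<and> ker i = \<theta>)" for \<theta>
  have j: "j \<theta> \<in> I" "ker (j \<theta>) = \<theta>" if "\<theta> \<in> ker ` I" for \<theta>
    using someI_ex[of "\<lambda>i. i \<in> I \<and> ker i = \<theta>"] that by (auto simp: j_def)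
  define h where "h \<theta> b = {x \<in> carrier M. f x (j \<theta>) = b}" for \<theta> b
  define B where "B \<theta> = lm_image (h \<theta>) (A (j \<theta>))" for \<theta>
  define g where "g x = (\<lambda>\<theta>\<in>ker ` I. h \<theta> (f x (j \<theta>)))" for x
  have inj: "inj_on (h \<theta>) (carrier (A (j \<theta>)))" if "\<theta> \<in> ker ` I" for \<theta>
    unfolding surj[OF j(1)[OF that], symmetric] by (auto simp: inj_on_def h_def)
  have mem: "f x (j \<theta>) \<in> carrier (A (j \<theta>))" if "x \<in> carrier M" "\<theta> \<in> ker ` I" for x \<theta>
    using fc[OF that(1)] j(1)[OF that(2)] by auto
  note sm = lm_image_simps[OF inj] 
  have "subdirect_embedding M (ker ` I) B g"
    unfolding subdirect_embedding_def
  proof (intro conjI ballI)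
    show "distributive_lmonoid (B \<theta>)" if "\<theta> \<in> ker ` I" for \<theta>
      unfolding B_def using that by (intro distributive_lmonoid_image A j inj)
    show "g \<in> lm_hom M (lm_product (ker ` I) B)"
      unfolding lm_hom_def hom_def lm_product_def
      by (auto simp: g_def B_def sm mem meet_closed join_closed fm f1 j(1) intro!: restrict_ext)
    show "inj_on g (carrier M)"
    proof (rule inj_onI)
      fix x y assume xy: "x \<in> carrier M" "y \<in> carrier M" "g x = g y"
      have "f x i = f y i" if i: "i \<in> I" for i
      proof -
        have k: "ker i \<in> ker ` I" using i by simp
        have "h (ker i) (f x (j (ker i))) = h (ker i) (f y (j (ker i)))"
          using fun_cong[OF xy(3), of "ker i"] k by (simp add: g_def)
        then have "(x, y) \<in> ker (j (ker i))" using xy by (auto simp: h_def ker_def)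
        then show ?thesis unfolding j(2)[OF k] by (auto simp: ker_def)
      qed
      then have "f x = f y" using fc xy by (metis PiE_ext)
      then show "x = y" using f xy by (auto simp: subdirect_embedding_def dest: inj_onD)
    qed
    show "(\<lambda>x. g x \<theta>) ` carrier M = carrier (B \<theta>)" if "\<theta> \<in> ker ` I" for \<theta>
      using that surj[OF j(1)[OF that], symmetric] by (auto simp: g_def B_def sm image_image)
  qed
  then obtain \<theta> where \<theta>: "\<theta> \<in> ker ` I" and iso: "(\<lambda>x. g x \<theta>) \<in> lm_iso M (B \<theta>)"
    using si[unfolded subdirectly_irreducible_def, rule_format, of "ker ` I" B g] by blast
  have "inj_on (\<lambda>x. g x \<theta>) (carrier M)" using iso by (simp add: lm_iso_def bij_betw_def)
  then have "inj_on (\<lambda>x. f x (j \<theta>)) (carrier M)"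
    using \<theta> by (simp add: inj_on_def g_def)
  then have "(\<lambda>x. f x (j \<theta>)) \<in> lm_iso M (A (j \<theta>))"
    by (simp add: lm_iso_def bij_betw_def lm_hom_def hom_def surj[OF j(1)[OF \<theta>]]
        fm[OF _ _ j(1)[OF \<theta>]] f1[OF j(1)[OF \<theta>]] mem[OF _ \<theta>])
  then show ?thesis using j(1)[OF \<theta>] by blast
qed

text \<open>Each algebra carries the order of \<open>int\<close>. The elements of \<open>{\<bottom> < e < \<top>}\<close> are encoded as \<open>-1 < 0 < 1\<close>.\<close>

definition C2 :: "int lmonoid" where
  "C2 = \<lparr>carrier = {-1, 0}, mult = min, one = 0, lmeet = min, ljoin = max\<rparr>"

definition C2d :: "int lmonoid" where
  "C2d = \<lparr>carrier = {0, 1}, mult = max, one = 0, lmeet = min, ljoin = max\<rparr>"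

definition G3 :: "int lmonoid" where
  "G3 = \<lparr>carrier = {-1, 0, 1}, mult = (\<lambda>x y. if x = 0 then y else x), one = 0,
         lmeet = min, ljoin = max\<rparr>"

definition D3 :: "int lmonoid" where
  "D3 = \<lparr>carrier = {-1, 0, 1}, mult = (\<lambda>x y. if y = 0 then x else y), one = 0,
         lmeet = min, ljoin = max\<rparr>"

lemma four_algebras_distinct: "distinct [C2, C2d, G3, D3]"
proof -
  have "1 \<notin> carrier C2" "1 \<in> carrier C2d" "1 \<in> carrier G3" "1 \<in> carrier D3"
    "-1 \<notin> carrier C2d" "-1 \<in> carrier G3" "-1 \<in> carrier D3"
    by (simp_all add: C2_def C2d_def G3_def D3_def)
  moreover have "mult G3 (-1) 1 \<noteq> mult D3 (-1) 1" by (simp add: G3_def D3_def)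
  then have "G3 \<noteq> D3" by metis
  ultimately show ?thesis by (metis distinct_length_2_or_more distinct_singleton)
qed

text \<open>Nested sum of idempotent ordered monoids whose carriers meet exactly in the common
  identity. The relation \<open>nested_order\<close> consists exactly of the pairs forced by the construction; it
  is already a total order on the union, hence the least extension, and meet and join are read
  off from it.\<close>

definition nested_order :: "'a lmonoid \<Rightarrow> 'a lmonoid \<Rightarrow> ('a \<times> 'a) set" where
  "nested_order M N =
     {(x, y). x \<in> carrier M \<and> y \<in> carrier M \<and> lm_le M x y} \<union>
     {(x, y). x \<in> carrier N \<and> y \<in> carrier N \<and> lm_le N x y} \<union>
     {(a, b). a \<in> carrier M - {\<one>\<^bsub>M\<^esub>} \<and> b \<in> carrier N \<and> lm_le M a \<one>\<^bsub>M\<^esub>} \<union>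
     {(b, a). a \<in> carrier M - {\<one>\<^bsub>M\<^esub>} \<and> b \<in> carrier N \<and> lm_le M \<one>\<^bsub>M\<^esub> a}"

definition nested_sum :: "'a lmonoid \<Rightarrow> 'a lmonoid \<Rightarrow> 'a lmonoid" (infixl \<open>\<boxplus>\<close> 65) where
  "M \<boxplus> N =
     \<lparr>carrier = carrier M \<union> carrier N,
      mult = (\<lambda>x y. if x \<in> carrier M \<and> y \<in> carrier M then x \<otimes>\<^bsub>M\<^esub> y
                    else if x \<in> carrier N \<and> y \<in> carrier N then x \<otimes>\<^bsub>N\<^esub> y
                    else if x \<in> carrier M then x else y),
      one = \<one>\<^bsub>M\<^esub>,
      lmeet = (\<lambda>x y. if (x, y) \<in> nested_order M N then x else y),
      ljoin = (\<lambda>x y. if (x, y) \<in> nested_order M N then y else x)\<rparr>"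

text \<open>Copy of \<open>M\<close> with identity \<open>None\<close>; copies with different tags share only \<open>None\<close>.\<close>

definition tagged_copy :: "nat \<Rightarrow> 'a lmonoid \<Rightarrow> (nat \<times> 'a) option lmonoid" where
  "tagged_copy i M = lm_image (\<lambda>x. if x = \<one>\<^bsub>M\<^esub> then None else Some (i, x)) M"

definition trivial_lm :: "'a option lmonoid" where
  "trivial_lm = \<lparr>carrier = {None}, mult = (\<lambda>_ _. None), one = None,
     lmeet = (\<lambda>_ _. None), ljoin = (\<lambda>_ _. None)\<rparr>"

text \<open>\<open>big_nested_sum n Ms\<close> is \<open>Ms 1 \<boxplus> \<dots> \<boxplus> Ms n\<close>, bracketed to the left; the empty sum is
  trivial, and the trivial algebra is neutral for \<open>\<boxplus>\<close>.\<close>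

primrec big_nested_sum :: "nat \<Rightarrow> (nat \<Rightarrow> 'a lmonoid) \<Rightarrow> (nat \<times> 'a) option lmonoid" where
  "big_nested_sum 0 Ms = trivial_lm"
| "big_nested_sum (Suc n) Ms = big_nested_sum n Ms \<boxplus> tagged_copy (Suc n) (Ms (Suc n))"

end

theory Submission
  imports Defs
begin

text \<open>
  The proof turns all three conditions into statements about one combinatorial picture of \<open>M\<close>.

  Reduction to chains. Every ordered monoid satisfies the equation expressing
  \<open>axb \<and> cyd \<le> ayb \<or> cxd\<close> (\<open>semilinear_exchange\<close>), hence so does \<open>M\<close>. For a join-prime
  element \<open>p\<close> the relation "\<open>p \<le> uxv\<close> and \<open>p \<le> uyv\<close> are equivalent for all \<open>u, v\<close>" is a
  congruence, and the inequality makes its quotient a chain. In a finite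
  distributive lattice the join-primes separate points, so a subdirectly irreducible \<open>M\<close> is
  isomorphic to one of these quotients and is itself a chain
  (\<open>subdirectly_irreducible_semilinear_total\<close>). This takes the place of Jonsson's lemma.

  The picture. In an idempotent chain \<open>xy\<close> is always \<open>x\<close> or \<open>y\<close>, so \<open>xyx = x\<close> (\<open>x\<close> absorbs
  \<open>y\<close>, the \<open>J\<close>-order of the band) is a total preorder. A class of this preorder other than
  \<open>{e}\<close> contains at most one element below \<open>e\<close> and at most one above \<open>e\<close>. Numbering the
  classes from the strongest one inwards puts every element at a level with a sign, and levels
  and signs determine the order, and also all products except those inside a two-element class,
  which is a left-zero or a right-zero band. This is the locale \<open>layered_lmonoid\<close>. The classes
  at the successive levels are the summands \<open>C2\<close>, \<open>C2d\<close>, \<open>G3\<close>, \<open>D3\<close> of a nested sum, so being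
  layered with \<open>n\<close> levels below the identity is the same as being isomorphic to a nested sum of
  \<open>n\<close> of the four algebras (\<open>isomorphic_nested_sum\<close>, \<open>isomorphic_nested_sum_imp_layered\<close>).
  The condition on neighbouring summands becomes \<open>alternating\<close>: no two consecutive levels
  consist of a single element each, with the same sign.

  Congruences. If the picture is alternating, a congruence that relates \<open>x\<close> to some other
  element at the same level or further inside relates \<open>x\<close> to everything at its level and
  further inside (\<open>alternating_congruence\<close>); any two congruences are then comparable. A finite
  chain of congruences has a least nontrivial member, which gives subdirect irreducibility. If
  the picture is not alternating, two neighbouring single elements \<open>a\<close>, \<open>b\<close> of the same sign can
  be identified without further consequences, and everything from \<open>b\<close> inwards can be collapsed
  without touching \<open>a\<close>. These congruences are nontrivial and meet in the identity, which
  excludes subdirect irreducibility (\<open>subdirectly_irreducible_imp_alternating\<close>).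
\<close>

section \<open>Congruences and subdirect irreducibility\<close>

definition quotient_lm :: "'a lmonoid \<Rightarrow> ('a \<times> 'a) set \<Rightarrow> 'a set lmonoid" where
  "quotient_lm M \<theta> = (let r = (\<lambda>X. SOME x. x \<in> X) in
     \<lparr>carrier = carrier M // \<theta>,
      mult = (\<lambda>X Y. \<theta> `` {r X \<otimes>\<^bsub>M\<^esub> r Y}),
      one = \<theta> `` {\<one>\<^bsub>M\<^esub>},
      lmeet = (\<lambda>X Y. \<theta> `` {r X \<curlywedge>\<^bsub>M\<^esub> r Y}),
      ljoin = (\<lambda>X Y. \<theta> `` {r X \<curlyvee>\<^bsub>M\<^esub> r Y})\<rparr>)"

context distributive_lmonoid
begin

lemma congruence_equiv: "\<theta> \<in> congruences M \<Longrightarrow> equiv (carrier M) \<theta>"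
  by (simp add: congruences_def)

lemma congruence_compat:
  assumes "\<theta> \<in> congruences M" "(a, b) \<in> \<theta>" "(c, d) \<in> \<theta>"
  shows "(a \<otimes> c, b \<otimes> d) \<in> \<theta>" "(a \<curlywedge> c, b \<curlywedge> d) \<in> \<theta>" "(a \<curlyvee> c, b \<curlyvee> d) \<in> \<theta>"
  using assms by (auto simp: congruences_def)

lemma congruence_carrier:
  assumes "\<theta> \<in> congruences M" "(a, b) \<in> \<theta>"
  shows "a \<in> carrier M" "b \<in> carrier M"
  using congruence_equiv[OF assms(1)] assms(2) by (auto simp: equiv_def refl_on_def)

lemma congruence_refl: "\<theta> \<in> congruences M \<Longrightarrow> a \<in> carrier M \<Longrightarrow> (a, a) \<in> \<theta>"
  using congruence_equiv[of \<theta>] by (auto simp: equiv_def refl_on_def)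

lemma congruence_sym: "\<theta> \<in> congruences M \<Longrightarrow> (a, b) \<in> \<theta> \<Longrightarrow> (b, a) \<in> \<theta>"
  using congruence_equiv[of \<theta>] by (auto simp: equiv_def dest: symD)

lemma congruence_trans:
  "\<theta> \<in> congruences M \<Longrightarrow> (a, b) \<in> \<theta> \<Longrightarrow> (b, c) \<in> \<theta> \<Longrightarrow> (a, c) \<in> \<theta>"
  using congruence_equiv[of \<theta>] by (auto simp: equiv_def dest: transD)

lemma congruence_class_eq_iff:
  assumes "\<theta> \<in> congruences M" "x \<in> carrier M" "y \<in> carrier M"
  shows "\<theta> `` {x} = \<theta> `` {y} \<longleftrightarrow> (x, y) \<in> \<theta>"
  using eq_equiv_class_iff[OF congruence_equiv[OF assms(1)]] assms(2,3) by simp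

text \<open>Compatibility needs to be checked for translations only: a simultaneous replacement of both
  arguments is two translations in succession, by transitivity.\<close>

lemma congruenceI:
  assumes eq: "equiv (carrier M) \<theta>"
    and compat: "\<And>x y z. (x, y) \<in> \<theta> \<Longrightarrow> z \<in> carrier M \<Longrightarrow>
      (x \<otimes> z, y \<otimes> z) \<in> \<theta> \<and> (z \<otimes> x, z \<otimes> y) \<in> \<theta> \<and> (x \<curlywedge> z, y \<curlywedge> z) \<in> \<theta> \<and> (x \<curlyvee> z, y \<curlyvee> z) \<in> \<theta>"
  shows "\<theta> \<in> congruences M"
proof -
  have c: "a \<in> carrier M" "b \<in> carrier M" if "(a, b) \<in> \<theta>" for a b
    using eq that by (auto simp: equiv_def refl_on_def)
  have tr: "(a, d) \<in> \<theta>" if "(a, b) \<in> \<theta>" "(b, d) \<in> \<theta>" for a b d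
    using eq that by (auto simp: equiv_def dest: transD)
  have "(a \<otimes> c, b \<otimes> d) \<in> \<theta> \<and> (a \<curlywedge> c, b \<curlywedge> d) \<in> \<theta> \<and> (a \<curlyvee> c, b \<curlyvee> d) \<in> \<theta>"
    if ab: "(a, b) \<in> \<theta>" and cd: "(c, d) \<in> \<theta>" for a b c d
  proof -
    note 1 = compat[OF ab c(1)[OF cd]] and 2 = compat[OF cd c(2)[OF ab]]
    then show ?thesis
      using meet_comm[OF c(2)[OF ab] c(1)[OF cd]] meet_comm[OF c(2)[OF ab] c(2)[OF cd]]
        join_comm[OF c(2)[OF ab] c(1)[OF cd]] join_comm[OF c(2)[OF ab] c(2)[OF cd]]
      by (auto intro: tr)
  qed
  then show ?thesis using eq unfolding congruences_def by fast
qed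

lemma quotient_lm_simps:
  assumes \<theta>: "\<theta> \<in> congruences M"
  shows "carrier (quotient_lm M \<theta>) = (\<lambda>x. \<theta> `` {x}) ` carrier M"
    and "\<one>\<^bsub>quotient_lm M \<theta>\<^esub> = \<theta> `` {\<one>}"
    and "\<lbrakk>x \<in> carrier M; y \<in> carrier M\<rbrakk> \<Longrightarrow>
      \<theta> `` {x} \<otimes>\<^bsub>quotient_lm M \<theta>\<^esub> \<theta> `` {y} = \<theta> `` {x \<otimes> y}"
    and "\<lbrakk>x \<in> carrier M; y \<in> carrier M\<rbrakk> \<Longrightarrow>
      \<theta> `` {x} \<curlywedge>\<^bsub>quotient_lm M \<theta>\<^esub> \<theta> `` {y} = \<theta> `` {x \<curlywedge> y}"
    and "\<lbrakk>x \<in> carrier M; y \<in> carrier M\<rbrakk> \<Longrightarrow>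
      \<theta> `` {x} \<curlyvee>\<^bsub>quotient_lm M \<theta>\<^esub> \<theta> `` {y} = \<theta> `` {x \<curlyvee> y}"
proof -
  have r: "(SOME z. z \<in> \<theta> `` {x}, x) \<in> \<theta>" if "x \<in> carrier M" for x
  proof -
    have "x \<in> \<theta> `` {x}" using congruence_refl[OF \<theta> that] by simp
    then have "(SOME z. z \<in> \<theta> `` {x}) \<in> \<theta> `` {x}" by (rule someI)
    then show ?thesis by (auto intro: congruence_sym[OF \<theta>])
  qed
  have q: "\<theta> `` {a} = \<theta> `` {b}" if "(a, b) \<in> \<theta>" for a b
    using that congruence_class_eq_iff[OF \<theta>] congruence_carrier[OF \<theta>] by blast
  show "carrier (quotient_lm M \<theta>) = (\<lambda>x. \<theta> `` {x}) ` carrier M"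
    by (auto simp: quotient_lm_def Let_def quotient_def)
  show "\<one>\<^bsub>quotient_lm M \<theta>\<^esub> = \<theta> `` {\<one>}" by (simp add: quotient_lm_def Let_def)
  assume xy: "x \<in> carrier M" "y \<in> carrier M"
  note c = congruence_compat[OF \<theta> r[OF xy(1)] r[OF xy(2)]]
  show "\<theta> `` {x} \<otimes>\<^bsub>quotient_lm M \<theta>\<^esub> \<theta> `` {y} = \<theta> `` {x \<otimes> y}"
    using q[OF c(1)] by (simp add: quotient_lm_def Let_def)
  show "\<theta> `` {x} \<curlywedge>\<^bsub>quotient_lm M \<theta>\<^esub> \<theta> `` {y} = \<theta> `` {x \<curlywedge> y}"
    using q[OF c(2)] by (simp add: quotient_lm_def Let_def)
  show "\<theta> `` {x} \<curlyvee>\<^bsub>quotient_lm M \<theta>\<^esub> \<theta> `` {y} = \<theta> `` {x \<curlyvee> y}"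
    using q[OF c(3)] by (simp add: quotient_lm_def Let_def)
qed

lemma distributive_lmonoid_quotient:
  assumes "\<theta> \<in> congruences M"
  shows "distributive_lmonoid (quotient_lm M \<theta>)"
proof -
  note sm = quotient_lm_simps[OF assms]
  note cl = meet_closed join_closed
  note axs = m_assoc meet_comm join_comm meet_assoc join_assoc meet_absorb join_absorb
    meet_join_distrib mult_join mult_meet
  show ?thesis
    apply (unfold_locales; unfold sm(1,2); (elim imageE)?)
    apply (simp_all only: sm cl m_closed one_closed l_one r_one)
    apply ((rule imageI, intro cl m_closed one_closed; assumption) |
        (rule arg_cong[where f = "\<lambda>x. \<theta> `` {x}"], rule axs; assumption))+
    done
qed

text \<open>The canonical map of \<open>M\<close> into the product of its quotients by a separating family of
  congruences is a subdirect embedding. One projection is an isomorphism, so the corresponding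
  congruence is trivial. This is the only form in which subdirect irreducibility is used below.\<close>

lemma subdirectly_irreducible_congruences:
  assumes si: "subdirectly_irreducible M"
    and C: "C \<subseteq> congruences M"
    and sep: "\<And>x y. \<lbrakk>x \<in> carrier M; y \<in> carrier M; \<forall>\<theta>\<in>C. (x, y) \<in> \<theta>\<rbrakk> \<Longrightarrow> x = y"
  obtains \<theta> where "\<theta> \<in> C" "\<theta> \<subseteq> Id"
proof -
  define f where "f x = (\<lambda>\<theta>\<in>C. \<theta> `` {x})" for x
  note sm = quotient_lm_simps[OF subsetD[OF C]]
  have "subdirect_embedding M C (quotient_lm M) f"
    unfolding subdirect_embedding_def
  proof (intro conjI ballI)
    show "distributive_lmonoid (quotient_lm M \<theta>)" if "\<theta> \<in> C" for \<theta>
      using distributive_lmonoid_quotient that C by blast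
    show "f \<in> lm_hom M (lm_product C (quotient_lm M))"
      unfolding lm_hom_def hom_def lm_product_def
      by (auto simp: f_def sm meet_closed join_closed intro!: restrict_ext)
    show "inj_on f (carrier M)"
    proof (rule inj_onI)
      fix x y assume xy: "x \<in> carrier M" "y \<in> carrier M" "f x = f y"
      have "(x, y) \<in> \<theta>" if "\<theta> \<in> C" for \<theta>
        using fun_cong[OF xy(3), of \<theta>] that xy C congruence_class_eq_iff by (auto simp: f_def)
      then show "x = y" using sep xy by blast
    qed
    show "(\<lambda>x. f x \<theta>) ` carrier M = carrier (quotient_lm M \<theta>)" if "\<theta> \<in> C" for \<theta>
      using that by (simp add: f_def sm)
  qed
  then obtain \<theta> where \<theta>: "\<theta> \<in> C" "(\<lambda>x. f x \<theta>) \<in> lm_iso M (quotient_lm M \<theta>)"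
    using si unfolding subdirectly_irreducible_def by blast
  then have inj: "inj_on (\<lambda>x. f x \<theta>) (carrier M)" by (simp add: lm_iso_def bij_betw_def)
  have "x = y" if "(x, y) \<in> \<theta>" for x y
  proof -
    have "x \<in> carrier M" "y \<in> carrier M" using that congruence_carrier \<theta>(1) C by blast+
    moreover from this have "f x \<theta> = f y \<theta>"
      using that \<theta>(1) congruence_class_eq_iff[OF subsetD[OF C \<theta>(1)]] by (simp add: f_def)
    ultimately show ?thesis using inj by (auto dest: inj_onD)
  qed
  then have "\<theta> \<subseteq> Id" by auto
  then show thesis by (rule that[OF \<theta>(1)])
qed

text \<open>The kernels of the projections of a subdirect embedding are finitely many congruences with
  trivial intersection.\<close>

lemma chain_congruences_imp_subdirectly_irreducible:
  assumes fin: "finite (carrier M)" and nontrivial: "carrier M \<noteq> {\<one>}"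
    and chain: "chain\<^sub>\<subseteq> (congruences M)"
  shows "subdirectly_irreducible M"
  unfolding subdirectly_irreducible_def
proof (intro allI impI)
  fix I :: "('a \<times> 'a) set set" and A :: "('a \<times> 'a) set \<Rightarrow> 'a set lmonoid" and f
  assume f: "subdirect_embedding M I A f"
  have hom: "(\<lambda>x. f x i) \<in> lm_hom M (A i)" if "i \<in> I" for i
    using f that
    by (fastforce simp: subdirect_embedding_def lm_hom_def hom_def lm_product_def PiE_mem)
  have surj: "(\<lambda>x. f x i) ` carrier M = carrier (A i)" if "i \<in> I" for i
    using f that by (simp add: subdirect_embedding_def)
  have fc: "f x \<in> (\<Pi>\<^sub>E i\<in>I. carrier (A i))" if "x \<in> carrier M" for x
    using f that by (auto simp: subdirect_embedding_def lm_hom_def hom_def lm_product_def)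
  define ker where "ker i = {(x, y). x \<in> carrier M \<and> y \<in> carrier M \<and> f x i = f y i}" for i
  have ker: "ker i \<in> congruences M" if "i \<in> I" for i
    using hom[OF that]
    by (auto simp: congruences_def ker_def equiv_def refl_on_def sym_def trans_def
        lm_hom_def hom_def meet_closed join_closed)
  have sep: "x = y" if "x \<in> carrier M" "y \<in> carrier M" "\<And>i. i \<in> I \<Longrightarrow> (x, y) \<in> ker i" for x y
  proof -
    have "f x = f y"
      by (rule PiE_ext[OF fc[OF that(1)] fc[OF that(2)]]) (use that(3) in \<open>simp add: ker_def\<close>)
    then show ?thesis using f that by (auto simp: subdirect_embedding_def dest: inj_onD)
  qed
  have "I \<noteq> {}" using sep one_closed nontrivial by fastforce
  moreover have "finite (ker ` I)"
    by (rule finite_subset[of _ "Pow (carrier M \<times> carrier M)"]) (auto simp: fin ker_def)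
  moreover have "chain\<^sub>\<subseteq> (ker ` I)" using chain ker by (auto simp: chain_subset_def)
  \<comment> \<open>A finite nonempty chain of kernels contains its own intersection.\<close>
  ultimately obtain m where "m \<in> ker ` I" "\<And>k. k \<in> ker ` I \<Longrightarrow> m \<subseteq> k"
    using finite_has_minimal[of "ker ` I"] unfolding chain_subset_def by (metis image_is_empty)
  then obtain i where i: "i \<in> I" "\<And>j. j \<in> I \<Longrightarrow> ker i \<subseteq> ker j" by blast
  have "inj_on (\<lambda>x. f x i) (carrier M)"
  proof (rule inj_onI)
    fix x y assume "x \<in> carrier M" "y \<in> carrier M" "f x i = f y i"
    then have "(x, y) \<in> ker i" by (simp add: ker_def)
    then show "x = y" using sep i(2) \<open>x \<in> _\<close> \<open>y \<in> _\<close> by blast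
  qed
  then have "(\<lambda>x. f x i) \<in> lm_iso M (A i)"
    using hom[OF i(1)] surj[OF i(1)] by (simp add: lm_iso_def bij_betw_def)
  then show "\<exists>i\<in>I. (\<lambda>x. f x i) \<in> lm_iso M (A i)" using i(1) by blast
qed

end

section \<open>Subdirectly irreducible semilinear algebras are totally ordered\<close>

context distributive_lmonoid
begin

lemma meet_idem: "x \<in> carrier M \<Longrightarrow> x \<curlywedge> x = x"
  by (metis join_absorb meet_absorb meet_closed)

lemma le_refl: "x \<in> carrier M \<Longrightarrow> lm_le M x x"
  by (simp add: lm_le_def meet_idem)

lemma le_trans:
  "\<lbrakk>x \<in> carrier M; y \<in> carrier M; z \<in> carrier M; lm_le M x y; lm_le M y z\<rbrakk> \<Longrightarrow> lm_le M x z"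
  unfolding lm_le_def by (metis meet_assoc)

lemma le_antisym:
  "\<lbrakk>x \<in> carrier M; y \<in> carrier M; lm_le M x y; lm_le M y x\<rbrakk> \<Longrightarrow> x = y"
  unfolding lm_le_def by (metis meet_comm)

lemma le_iff_join: "\<lbrakk>x \<in> carrier M; y \<in> carrier M\<rbrakk> \<Longrightarrow> lm_le M x y \<longleftrightarrow> x \<curlyvee> y = y"
  unfolding lm_le_def by (metis join_comm join_absorb meet_comm meet_absorb)

lemma le_meet_iff:
  assumes "p \<in> carrier M" "x \<in> carrier M" "y \<in> carrier M"
  shows "lm_le M p (x \<curlywedge> y) \<longleftrightarrow> lm_le M p x \<and> lm_le M p y"
  unfolding lm_le_def using assms meet_assoc meet_comm meet_closed
  by (metis (no_types, opaque_lifting) meet_idem)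

lemma meet_le: "\<lbrakk>x \<in> carrier M; y \<in> carrier M\<rbrakk> \<Longrightarrow> lm_le M (x \<curlywedge> y) x \<and> lm_le M (x \<curlywedge> y) y"
  using le_meet_iff[of "x \<curlywedge> y" x y] by (simp add: le_refl meet_closed)

lemma le_join: "\<lbrakk>x \<in> carrier M; y \<in> carrier M\<rbrakk> \<Longrightarrow> lm_le M x (x \<curlyvee> y) \<and> lm_le M y (x \<curlyvee> y)"
  unfolding lm_le_def using meet_absorb join_comm by metis

lemma mult_mono:
  assumes "a \<in> carrier M" "b \<in> carrier M" "c \<in> carrier M" "d \<in> carrier M" "lm_le M b c"
  shows "lm_le M (a \<otimes> b \<otimes> d) (a \<otimes> c \<otimes> d)"
  using mult_meet[of a b c d] assms by (simp add: lm_le_def)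

text \<open>In a chain either \<open>x \<le> y\<close>, and then \<open>axb \<le> ayb\<close>, or \<open>y \<le> x\<close>, and then \<open>cyd \<le> cxd\<close>.
  As an inequality between lattice terms is an equation, semilinearity transfers it.\<close>

lemma semilinear_exchange:
  assumes sl: "semilinear M" and carr: "x \<in> carrier M" "y \<in> carrier M"
    "a \<in> carrier M" "b \<in> carrier M" "c \<in> carrier M" "d \<in> carrier M"
  shows "lm_le M ((a \<otimes> x \<otimes> b) \<curlywedge> (c \<otimes> y \<otimes> d)) ((a \<otimes> y \<otimes> b) \<curlyvee> (c \<otimes> x \<otimes> d))"
proof -
  define pr where "pr i j k = TMult (TMult (TVar i) (TVar j)) (TVar k)" for i j k
  define L where "L = TMeet (pr 2 0 3) (pr 4 1 5)"
  define R where "R = TJoin (pr 2 1 3) (pr 4 0 5)"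
  have "satisfies_eq N (TMeet L R) L" if N: "ordered_monoid N" for N :: "nat lmonoid"
    unfolding satisfies_eq_def
  proof (intro allI impI)
    fix v :: "nat \<Rightarrow> nat" assume v: "range v \<subseteq> carrier N"
    interpret N: distributive_lmonoid N using N by (simp add: ordered_monoid_def)
    have vc: "v i \<in> carrier N" for i using v by auto
    let ?p = "\<lambda>i j k. v i \<otimes>\<^bsub>N\<^esub> v j \<otimes>\<^bsub>N\<^esub> v k"
    note cl = vc N.m_closed N.meet_closed N.join_closed
    have m1: "lm_le N (?p 2 0 3 \<curlywedge>\<^bsub>N\<^esub> ?p 4 1 5) (?p 2 0 3)"
      and m2: "lm_le N (?p 2 0 3 \<curlywedge>\<^bsub>N\<^esub> ?p 4 1 5) (?p 4 1 5)"
      using N.meet_le cl by simp_all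
    have j1: "lm_le N (?p 2 1 3) (?p 2 1 3 \<curlyvee>\<^bsub>N\<^esub> ?p 4 0 5)"
      and j2: "lm_le N (?p 4 0 5) (?p 2 1 3 \<curlyvee>\<^bsub>N\<^esub> ?p 4 0 5)"
      using N.le_join cl by simp_all
    have "lm_le N (v 0) (v 1) \<or> lm_le N (v 1) (v 0)"
      using N vc by (simp add: ordered_monoid_def)
    then have "lm_le N (?p 2 0 3 \<curlywedge>\<^bsub>N\<^esub> ?p 4 1 5) (?p 2 1 3 \<curlyvee>\<^bsub>N\<^esub> ?p 4 0 5)"
    proof
      assume "lm_le N (v 0) (v 1)"
      then have "lm_le N (?p 2 0 3) (?p 2 1 3)" by (intro N.mult_mono vc)
      from N.le_trans[OF _ _ _ m1 N.le_trans[OF _ _ _ this j1]]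
      show ?thesis by (simp add: cl)
    next
      assume "lm_le N (v 1) (v 0)"
      then have "lm_le N (?p 4 1 5) (?p 4 0 5)" by (intro N.mult_mono vc)
      from N.le_trans[OF _ _ _ m2 N.le_trans[OF _ _ _ this j2]]
      show ?thesis by (simp add: cl)
    qed
    then show "lm_eval N v (TMeet L R) = lm_eval N v L"
      by (simp add: L_def R_def pr_def lm_le_def)
  qed
  then have "satisfies_eq M (TMeet L R) L"
    using sl by (simp add: semilinear_def valid_in_ordered_monoids_def)
  moreover define v where "v = ((((((\<lambda>_::nat. \<one>)(0 := x))(1 := y))(2 := a))(3 := b))(4 := c))(5 := d)"
  moreover have "range v \<subseteq> carrier M" using carr by (auto simp: v_def)
  ultimately have "lm_eval M v (TMeet L R) = lm_eval M v L" by (simp add: satisfies_eq_def)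
  then show ?thesis by (simp add: L_def R_def pr_def lm_le_def v_def)
qed

text \<open>The syntactic congruence, in the sense of formal languages, of the principal filter
  generated by \<open>p\<close>.\<close>

definition syntactic_congruence :: "'a \<Rightarrow> ('a \<times> 'a) set" where
  "syntactic_congruence p = {(x, y). x \<in> carrier M \<and> y \<in> carrier M \<and>
     (\<forall>u\<in>carrier M. \<forall>v\<in>carrier M. lm_le M p (u \<otimes> x \<otimes> v) \<longleftrightarrow> lm_le M p (u \<otimes> y \<otimes> v))}"

definition join_prime :: "'a \<Rightarrow> bool" where
  "join_prime p \<longleftrightarrow> p \<in> carrier M \<and>
     (\<forall>x\<in>carrier M. \<forall>y\<in>carrier M. lm_le M p (x \<curlyvee> y) \<longrightarrow> lm_le M p x \<or> lm_le M p y)"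

text \<open>Membership of a meet in a principal filter is the conjunction of the two memberships;
  for a join-prime generator membership of a join is the disjunction. Together with the
  distribution of multiplication over both lattice operations this makes the relation a congruence.\<close>

lemma syntactic_congruence:
  assumes p: "join_prime p"
  shows "syntactic_congruence p \<in> congruences M"
proof (rule congruenceI)
  show "equiv (carrier M) (syntactic_congruence p)"
    by (auto simp: equiv_def refl_on_def sym_def trans_def syntactic_congruence_def)
  fix x y z assume xy: "(x, y) \<in> syntactic_congruence p" and z: "z \<in> carrier M"
  have c: "x \<in> carrier M" "y \<in> carrier M" "p \<in> carrier M"
    using xy p by (auto simp: syntactic_congruence_def join_prime_def)
  have iff: "lm_le M p (u \<otimes> x \<otimes> v) \<longleftrightarrow> lm_le M p (u \<otimes> y \<otimes> v)"
    if "u \<in> carrier M" "v \<in> carrier M" for u v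
    using xy that by (auto simp: syntactic_congruence_def)
  have pj: "lm_le M p (a \<curlyvee> b) \<longleftrightarrow> lm_le M p a \<or> lm_le M p b"
    if "a \<in> carrier M" "b \<in> carrier M" for a b
    using p that le_join[OF that] le_trans[OF c(3) _ join_closed[OF that]]
    unfolding join_prime_def by blast
  have "(x \<otimes> z, y \<otimes> z) \<in> syntactic_congruence p"
    using c z iff[of _ "z \<otimes> _"] by (auto simp: syntactic_congruence_def m_assoc)
  moreover have "(z \<otimes> x, z \<otimes> y) \<in> syntactic_congruence p"
  proof -
    have "u \<otimes> (z \<otimes> w) = (u \<otimes> z) \<otimes> w" if "u \<in> carrier M" "w \<in> carrier M" for u w
      using that z by (simp add: m_assoc)
    then show ?thesis using c z iff[of "_ \<otimes> z"] by (auto simp: syntactic_congruence_def)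
  qed
  moreover have "(x \<curlywedge> z, y \<curlywedge> z) \<in> syntactic_congruence p"
    using c z iff by (auto simp: syntactic_congruence_def meet_closed mult_meet le_meet_iff)
  moreover have "(x \<curlyvee> z, y \<curlyvee> z) \<in> syntactic_congruence p"
    using c z iff by (auto simp: syntactic_congruence_def join_closed mult_join pj)
  ultimately show "(x \<otimes> z, y \<otimes> z) \<in> syntactic_congruence p \<and>
      (z \<otimes> x, z \<otimes> y) \<in> syntactic_congruence p \<and> (x \<curlywedge> z, y \<curlywedge> z) \<in> syntactic_congruence p \<and>
      (x \<curlyvee> z, y \<curlyvee> z) \<in> syntactic_congruence p" by blast
qed

text \<open>Among the elements below \<open>x\<close> but not below \<open>y\<close> take a minimal one. If it were below
  \<open>a \<or> b\<close> but below neither \<open>a\<close> nor \<open>b\<close>, its meets with \<open>a\<close> and \<open>b\<close> would be strictly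
  smaller, hence both below \<open>y\<close>, and so would be their join, which is the element itself.\<close>

lemma join_prime_separation:
  assumes fin: "finite (carrier M)" and xy: "x \<in> carrier M" "y \<in> carrier M" "\<not> lm_le M x y"
  obtains p where "join_prime p" "lm_le M p x" "\<not> lm_le M p y"
proof -
  \<comment> \<open>Minimality is measured by the size of the principal down-set.\<close>
  define S where "S = {p \<in> carrier M. lm_le M p x \<and> \<not> lm_le M p y}"
  define below where "below p = {q \<in> carrier M. lm_le M q p}" for p
  have "finite S" "x \<in> S" using fin xy by (simp_all add: S_def le_refl)
  then obtain p where p: "p \<in> S" "\<And>q. q \<in> S \<Longrightarrow> card (below p) \<le> card (below q)"
    using ex_min_if_finite[of "(\<lambda>p. card (below p)) ` S"] by (fastforce simp: not_less)
  have min: "q = p" if "q \<in> S" "lm_le M q p" for q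
  proof -
    have c: "q \<in> carrier M" "p \<in> carrier M" using that(1) p(1) by (auto simp: S_def)
    have "below q \<subseteq> below p" unfolding below_def using c that(2) le_trans by blast
    moreover have "card (below p) \<le> card (below q)" using p(2) that(1) .
    ultimately have "below q = below p"
      by (intro card_seteq) (simp_all add: below_def fin)
    then have "lm_le M p q" using c le_refl by (auto simp: below_def)
    then show ?thesis using c that(2) le_antisym by blast
  qed
  have pc: "p \<in> carrier M" "lm_le M p x" "\<not> lm_le M p y" using p(1) by (auto simp: S_def)
  have "lm_le M p a \<or> lm_le M p b"
    if ab: "a \<in> carrier M" "b \<in> carrier M" "lm_le M p (a \<curlyvee> b)" for a b
  proof (rule ccontr)
    assume n: "\<not> ?thesis"
    have "lm_le M (p \<curlywedge> c) y" if c: "c \<in> carrier M" "\<not> lm_le M p c" for c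
    proof (rule ccontr)
      assume "\<not> lm_le M (p \<curlywedge> c) y"
      then have "p \<curlywedge> c \<in> S"
        using pc c meet_le[of p c] le_trans[of "p \<curlywedge> c" p x] xy by (auto simp: S_def meet_closed)
      then have "p \<curlywedge> c = p" using min meet_le[of p c] pc c by blast
      then show False using c by (simp add: lm_le_def)
    qed
    then have "lm_le M (p \<curlywedge> a) y" "lm_le M (p \<curlywedge> b) y" using n ab by blast+
    then have "(p \<curlywedge> a) \<curlyvee> (p \<curlywedge> b) \<curlyvee> y = y"
      using pc xy ab by (simp add: le_iff_join meet_closed join_assoc)
    moreover have "(p \<curlywedge> a) \<curlyvee> (p \<curlywedge> b) = p"
      using ab pc meet_join_distrib[of p a b] by (simp add: lm_le_def)
    ultimately show False using pc xy by (simp add: le_iff_join)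
  qed
  then have "join_prime p" using pc(1) by (simp add: join_prime_def)
  then show thesis using that pc(2,3) by blast
qed

text \<open>The syntactic congruences of the join-primes separate points, so one of them is trivial.
  For it, two incomparable elements would violate the exchange inequality.\<close>

lemma subdirectly_irreducible_semilinear_total:
  assumes si: "subdirectly_irreducible M" and sl: "semilinear M" and fin: "finite (carrier M)"
  shows "ordered_monoid M"
proof -
  have sep: "x = y" if "x \<in> carrier M" "y \<in> carrier M"
    "\<forall>\<theta>\<in>syntactic_congruence ` Collect join_prime. (x, y) \<in> \<theta>" for x y
  proof -
    have iff: "lm_le M p x \<longleftrightarrow> lm_le M p y" if "join_prime p" for p
    proof -
      have "(x, y) \<in> syntactic_congruence p" using that \<open>\<forall>\<theta>\<in>_. _\<close> by blast
      then have "lm_le M p (\<one> \<otimes> x \<otimes> \<one>) \<longleftrightarrow> lm_le M p (\<one> \<otimes> y \<otimes> \<one>)"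
        unfolding syntactic_congruence_def by blast
      then show ?thesis using \<open>x \<in> _\<close> \<open>y \<in> _\<close> by simp
    qed
    have "lm_le M x y" using join_prime_separation[OF fin that(1,2)] iff by blast
    moreover have "lm_le M y x" using join_prime_separation[OF fin that(2,1)] iff by blast
    ultimately show ?thesis using le_antisym that by blast
  qed
  obtain p where p: "join_prime p" "syntactic_congruence p \<subseteq> Id"
  proof (rule subdirectly_irreducible_congruences[OF si _ sep])
    show "syntactic_congruence ` Collect join_prime \<subseteq> congruences M"
      using syntactic_congruence by blast
  qed auto
  have pc: "p \<in> carrier M" using p(1) by (simp add: join_prime_def)
  have "lm_le M x y \<or> lm_le M y x" if xy: "x \<in> carrier M" "y \<in> carrier M" for x y
  proof -
    let ?imp = "\<lambda>x y. \<forall>u\<in>carrier M. \<forall>v\<in>carrier M. lm_le M p (u \<otimes> x \<otimes> v) \<longrightarrow> lm_le M p (u \<otimes> y \<otimes> v)"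
    \<comment> \<open>As the congruence is trivial, the implication between the filter conditions of \<open>a\<close> and
      \<open>b\<close> identifies \<open>a\<close> with \<open>a \<and> b\<close>.\<close>
    have le: "lm_le M a b" if "a \<in> carrier M" "b \<in> carrier M" "?imp a b" for a b
    proof -
      have "(a \<curlywedge> b, a) \<in> syntactic_congruence p"
        using that pc by (auto simp: syntactic_congruence_def meet_closed mult_meet le_meet_iff)
      then show ?thesis using p(2) by (auto simp: lm_le_def)
    qed
    have "?imp x y \<or> ?imp y x"
    proof (rule ccontr)
      assume "\<not> ?thesis"
      then obtain a b c d where c: "a \<in> carrier M" "b \<in> carrier M" "c \<in> carrier M" "d \<in> carrier M"
        and 1: "lm_le M p (a \<otimes> x \<otimes> b)" "\<not> lm_le M p (a \<otimes> y \<otimes> b)"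
          "lm_le M p (c \<otimes> y \<otimes> d)" "\<not> lm_le M p (c \<otimes> x \<otimes> d)" by blast
      have "lm_le M p ((a \<otimes> x \<otimes> b) \<curlywedge> (c \<otimes> y \<otimes> d))"
        using 1 c xy pc by (simp add: le_meet_iff)
      then have "lm_le M p ((a \<otimes> y \<otimes> b) \<curlyvee> (c \<otimes> x \<otimes> d))"
        by - (rule le_trans[OF _ _ _ _ semilinear_exchange[OF sl xy c]], simp_all add: c xy pc meet_closed join_closed)
      moreover have "a \<otimes> y \<otimes> b \<in> carrier M" "c \<otimes> x \<otimes> d \<in> carrier M" using c xy by simp_all
      ultimately show False using p(1) 1(2,4) unfolding join_prime_def by blast
    qed
    then show ?thesis using le xy by blast
  qed
  then show ?thesis by (simp add: ordered_monoid_def distributive_lmonoid_axioms)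
qed

end

section \<open>Layered algebras\<close>

text \<open>The position in the order of the element with sign \<open>\<sigma>\<close> at level \<open>i\<close>: outer levels, which have
  smaller numbers, lie further away from the identity, which has height \<open>0\<close> at level \<open>n + 1\<close>.\<close>

definition height :: "nat \<Rightarrow> nat \<Rightarrow> int \<Rightarrow> int" where
  "height n i \<sigma> = \<sigma> * (int (Suc n) - int i)"

text \<open>The assumptions describe a nested sum of \<open>n\<close> summands intrinsically. The level \<open>n + 1\<close>
  and the sign \<open>0\<close> are reserved for the identity, so that the rules for products, meets and joins
  apply to it without exception.\<close>

locale layered_lmonoid = distributive_lmonoid M for M :: "'a lmonoid" (structure) +
  fixes n :: nat and lev :: "'a \<Rightarrow> nat" and s :: "'a \<Rightarrow> int"
  assumes lev_image: "lev ` carrier M = {1..Suc n}"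
    and sign_range: "x \<in> carrier M \<Longrightarrow> s x \<in> {-1, 0, 1}"
    and lev_one_iff: "x \<in> carrier M \<Longrightarrow> lev x = Suc n \<longleftrightarrow> x = \<one>"
    and sign_zero_iff: "x \<in> carrier M \<Longrightarrow> s x = 0 \<longleftrightarrow> x = \<one>"
    and lev_sign_inj: "\<lbrakk>x \<in> carrier M; y \<in> carrier M; lev x = lev y; s x = s y\<rbrakk> \<Longrightarrow> x = y"
    and idem: "x \<in> carrier M \<Longrightarrow> x \<otimes> x = x"
    and mult_outer: "\<lbrakk>x \<in> carrier M; y \<in> carrier M; lev x < lev y\<rbrakk> \<Longrightarrow> x \<otimes> y = x \<and> y \<otimes> x = x"
    and mult_same: "\<lbrakk>x \<in> carrier M; y \<in> carrier M; lev x = lev y; x \<noteq> y\<rbrakk> \<Longrightarrow>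
      x \<otimes> y = x \<and> y \<otimes> x = y \<or> x \<otimes> y = y \<and> y \<otimes> x = x"
    and meet_height: "\<lbrakk>x \<in> carrier M; y \<in> carrier M\<rbrakk> \<Longrightarrow>
      x \<curlywedge> y = (if height n (lev x) (s x) \<le> height n (lev y) (s y) then x else y)"
    and join_height: "\<lbrakk>x \<in> carrier M; y \<in> carrier M\<rbrakk> \<Longrightarrow>
      x \<curlyvee> y = (if height n (lev x) (s x) \<le> height n (lev y) (s y) then y else x)"
begin

definition signs :: "nat \<Rightarrow> int set" where
  "signs i = s ` {x \<in> carrier M. lev x = i}"

text \<open>For a nested sum of the four algebras this says that neighbouring summands are not both
  \<open>C2\<close> and not both \<open>C2d\<close>.\<close>

definition alternating :: bool where
  "alternating \<longleftrightarrow> (\<forall>i\<in>{1..n - 1}. signs i = signs (i + 1) \<longrightarrow> signs i = {-1, 1})"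

lemma lev_bounds: "x \<in> carrier M \<Longrightarrow> 1 \<le> lev x \<and> lev x \<le> Suc n"
  using lev_image by auto

lemma lev_one: "lev \<one> = Suc n" and sign_one: "s \<one> = 0"
  using lev_one_iff sign_zero_iff by auto

lemma sign_cases:
  assumes "x \<in> carrier M" "x \<noteq> \<one>" shows "s x = 1 \<or> s x = -1"
  using assms sign_range sign_zero_iff by fastforce

lemma lev_less: "x \<in> carrier M \<Longrightarrow> x \<noteq> \<one> \<Longrightarrow> lev x \<le> n"
  using lev_bounds lev_one_iff le_Suc_eq by blast

lemma signs_subset: "i \<in> {1..n} \<Longrightarrow> signs i \<subseteq> {-1, 1}"
  using sign_cases lev_one by (fastforce simp: signs_def)

lemma signs_nonempty: "i \<in> {1..n} \<Longrightarrow> signs i \<noteq> {}"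
proof -
  assume "i \<in> {1..n}"
  then have "i \<in> lev ` carrier M" by (simp add: lev_image)
  then show ?thesis by (auto simp: signs_def)
qed

text \<open>Two elements of different signs have the identity between them or equal to one of them,
  and congruence classes are convex: taking the meet with \<open>e\<close> if \<open>x\<close> is negative and the join
  if it is positive fixes \<open>x\<close> and moves \<open>y\<close> to \<open>e\<close>.\<close>

lemma congruence_sign_change:
  assumes \<theta>: "\<theta> \<in> congruences M" and xy: "(x, y) \<in> \<theta>" "s x \<noteq> s y"
  shows "(x, \<one>) \<in> \<theta>"
proof (cases "x = \<one>")
  case True then show ?thesis using congruence_refl[OF \<theta>] by simp
next
  case False
  have c: "x \<in> carrier M" "y \<in> carrier M" using congruence_carrier[OF \<theta> xy(1)] .
  have lx: "lev x \<le> n" and ly: "lev y \<le> Suc n" using lev_less lev_bounds c False by auto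
  have sy: "s y \<in> {-1, 0, 1}" using sign_range c by blast
  have one: "(\<one>, \<one>) \<in> \<theta>" using congruence_refl[OF \<theta>] by simp
  note cm = congruence_compat(2,3)[OF \<theta> xy(1) one]
  consider "s x = -1" | "s x = 1" using sign_cases c False by blast
  then show ?thesis
  proof cases
    case 1
    then have "s y = 0 \<or> s y = 1" using sy xy(2) by auto
    then have "x \<curlywedge> \<one> = x" "y \<curlywedge> \<one> = \<one>"
      using 1 lx ly c lev_less sign_zero_iff by (fastforce simp: meet_height lev_one sign_one height_def)+
    then show ?thesis using cm(1) by simp
  next
    case 2
    then have "s y = 0 \<or> s y = -1" using sy xy(2) by auto
    then have "x \<curlyvee> \<one> = x" "y \<curlyvee> \<one> = \<one>"
      using 2 lx ly c lev_less sign_zero_iff by (fastforce simp: join_height lev_one sign_one height_def)+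
    then show ?thesis using cm(2) by simp
  qed
qed

text \<open>If \<open>x\<close> is related to \<open>e\<close>, then both products of \<open>x\<close> and \<open>z\<close> are related to \<open>z\<close>. For \<open>z\<close>
  at the level of \<open>x\<close> or further inside, at least one of these products is \<open>x\<close>.\<close>

lemma congruence_one_imp_inner:
  assumes \<theta>: "\<theta> \<in> congruences M" and x: "(x, \<one>) \<in> \<theta>"
    and z: "z \<in> carrier M" "lev x \<le> lev z"
  shows "(x, z) \<in> \<theta>"
proof -
  have xc: "x \<in> carrier M" using congruence_carrier[OF \<theta> x] by blast
  note zz = congruence_refl[OF \<theta> z(1)]
  have "(x \<otimes> z, z) \<in> \<theta>" "(z \<otimes> x, z) \<in> \<theta>"
    using congruence_compat(1)[OF \<theta> x zz] congruence_compat(1)[OF \<theta> zz x] z by simp_all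
  moreover have "x = z \<or> x \<otimes> z = x \<or> z \<otimes> x = x"
    using mult_outer[OF xc z(1)] mult_same[OF xc z(1)] z(2) by (cases "lev x = lev z") auto
  ultimately show ?thesis using zz by auto
qed

text \<open>It suffices to relate \<open>x\<close> to an element of a different sign, and hence to \<open>e\<close>. If \<open>y\<close> has
  the sign of \<open>x\<close>, the alternation condition provides an element \<open>w\<close> of another sign at a level
  between those of \<open>x\<close> and \<open>y\<close>, ends included. Multiplying by \<open>w\<close> from a suitable side fixes
  \<open>x\<close> and moves \<open>y\<close> to \<open>w\<close>.\<close>

lemma alternating_congruence:
  assumes alt: alternating and \<theta>: "\<theta> \<in> congruences M"
    and xy: "(x, y) \<in> \<theta>" "x \<noteq> y" "lev x \<le> lev y"
    and z: "z \<in> carrier M" "lev x \<le> lev z"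
  shows "(x, z) \<in> \<theta>"
proof -
  have c: "x \<in> carrier M" "y \<in> carrier M" using congruence_carrier[OF \<theta> xy(1)] .
  have "(x, \<one>) \<in> \<theta>"
  proof (cases "s x = s y")
    case False
    then show ?thesis using congruence_sign_change[OF \<theta> xy(1)] by blast
  next
    case True
    then have less: "lev x < lev y" using xy c lev_sign_inj by fastforce
    then have ne: "x \<noteq> \<one>" "y \<noteq> \<one>" using True sign_zero_iff c xy(2) by metis+
    then have ly: "lev y \<le> n" using lev_less c by blast
    have "\<exists>w\<in>carrier M. lev x \<le> lev w \<and> lev w \<le> lev y \<and> s w \<noteq> s x"
    proof (rule ccontr)
      assume no: "\<not> ?thesis"
      have "signs i = {s x}" if "lev x \<le> i" "i \<le> lev y" for i
      proof -
        have "signs i \<noteq> {}" using signs_nonempty[of i] that ly lev_bounds[OF c(1)] by simp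
        then show ?thesis using no that by (auto simp: signs_def)
      qed
      from this[of "lev x"] this[of "lev x + 1"]
      have "signs (lev x) = {s x}" "signs (lev x + 1) = {s x}" using less by auto
      moreover have "lev x \<in> {1..n - 1}" using less ly lev_bounds[OF c(1)] by auto
      ultimately have "{s x} = {-1, 1}" using alt unfolding alternating_def by metis
      then show False by (auto simp: doubleton_eq_iff singleton_insert_inj_eq)
    qed
    then obtain w where w: "w \<in> carrier M" "lev x \<le> lev w" "lev w \<le> lev y" "s w \<noteq> s x" by blast
    have wx: "w \<noteq> x" and wy: "w \<noteq> y" using w(4) True by auto
    note ww = congruence_refl[OF \<theta> w(1)]
    have p: "(x \<otimes> w, y \<otimes> w) \<in> \<theta>" "(w \<otimes> x, w \<otimes> y) \<in> \<theta>"
      using congruence_compat(1)[OF \<theta> xy(1) ww] congruence_compat(1)[OF \<theta> ww xy(1)] by simp_all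
    have "x \<otimes> w = x \<and> y \<otimes> w = w \<or> w \<otimes> x = x \<and> w \<otimes> y = w"
    proof -
      consider "lev w = lev x" | "lev x < lev w" "lev w < lev y" | "lev w = lev y"
        using w by linarith
      then show ?thesis
      proof cases
        case 1
        then show ?thesis using mult_same[OF c(1) w(1)] mult_outer[OF w(1) c(2)] wx less by auto
      next
        case 2
        then show ?thesis using mult_outer[OF c(1) w(1)] mult_outer[OF w(1) c(2)] by auto
      next
        case 3
        then show ?thesis using mult_same[OF c(2) w(1)] mult_outer[OF c(1) w(1)] wy less by auto
      qed
    qed
    then have "(x, w) \<in> \<theta>" using p by auto
    then show ?thesis using congruence_sign_change[OF \<theta>] w(4) by metis
  qed
  then show ?thesis using congruence_one_imp_inner[OF \<theta>] z by blast
qed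

text \<open>Incomparable congruences would each contain a pair missing from the other. The congruence
  whose pair starts at the outer level also collapses all levels of the other pair.\<close>

lemma alternating_imp_chain:
  assumes alt: alternating
  shows "chain\<^sub>\<subseteq> (congruences M)"
proof -
  have ord: "\<exists>x y. (x, y) \<in> \<alpha> \<and> (x, y) \<notin> \<beta> \<and> lev x \<le> lev y"
    if "\<alpha> \<in> congruences M" "\<beta> \<in> congruences M" "\<not> \<alpha> \<subseteq> \<beta>" for \<alpha> \<beta>
    using that congruence_sym by (metis linear subrelI)
  have key: False
    if \<alpha>: "\<alpha> \<in> congruences M" and \<beta>: "\<beta> \<in> congruences M"
      and x: "(x, y) \<in> \<alpha>" "lev x \<le> lev y" and u: "(u, v) \<in> \<beta>" "(u, v) \<notin> \<alpha>" "lev u \<le> lev v"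
      and ne: "(x, y) \<notin> \<beta>" and le: "lev x \<le> lev u" for \<alpha> \<beta> x y u v
  proof -
    have uv: "u \<in> carrier M" "v \<in> carrier M" using congruence_carrier \<beta> u(1) by blast+
    have "x \<noteq> y" using ne congruence_refl congruence_carrier \<alpha> \<beta> x(1) by metis
    then have "(x, u) \<in> \<alpha>" "(x, v) \<in> \<alpha>"
      using alternating_congruence[OF alt \<alpha> x(1) _ x(2)] uv le u(3) by auto
    then show False using congruence_trans[OF \<alpha> congruence_sym[OF \<alpha>]] u(2) by blast
  qed
  show ?thesis
    unfolding chain_subset_def
  proof (intro ballI)
    fix \<alpha> \<beta> assume ab: "\<alpha> \<in> congruences M" "\<beta> \<in> congruences M"
    show "\<alpha> \<subseteq> \<beta> \<or> \<beta> \<subseteq> \<alpha>"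
    proof (rule ccontr)
      assume "\<not> ?thesis"
      then obtain x y u v where 1: "(x, y) \<in> \<alpha>" "(x, y) \<notin> \<beta>" "lev x \<le> lev y"
        and 2: "(u, v) \<in> \<beta>" "(u, v) \<notin> \<alpha>" "lev u \<le> lev v"
        using ord ab by meson
      show False
      proof (cases "lev x \<le> lev u")
        case True then show False using key[OF ab 1(1,3) 2 1(2)] by blast
      next
        case False
        then show False using key[OF ab(2,1) 2(1,3) 1 2(2)] by linarith
      qed
    qed
  qed
qed

text \<open>All levels beyond \<open>i\<close>, the identity included, form one class. For \<open>i \<le> n\<close> these are the kernels of the
  projections of a nested sum onto its first \<open>i\<close> summands.\<close>

definition inner_collapse :: "nat \<Rightarrow> ('a \<times> 'a) set" where
  "inner_collapse i = {(x, y). x \<in> carrier M \<and> y \<in> carrier M \<and> (x = y \<or> i < lev x \<and> i < lev y)}"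

lemma mult_lev:
  assumes "x \<in> carrier M" "y \<in> carrier M" shows "lev (x \<otimes> y) = min (lev x) (lev y)"
  using mult_outer[OF assms] mult_outer[OF assms(2,1)] mult_same[OF assms] idem[OF assms(1)]
  by (cases "lev x" "lev y" rule: linorder_cases; cases "x = y") auto

text \<open>An element at one of the levels \<open>1, \<dots>, i\<close> absorbs all inner elements and lies on one side
  of all of them, so none of the operations with it tells inner elements apart.\<close>

lemma inner_collapse: "inner_collapse i \<in> congruences M"
proof (rule congruenceI)
  show "equiv (carrier M) (inner_collapse i)"
    by (auto simp: equiv_def refl_on_def sym_def trans_def inner_collapse_def)
  fix x y z assume "(x, y) \<in> inner_collapse i" and z: "z \<in> carrier M"
  then have c: "x \<in> carrier M" "y \<in> carrier M" and xy: "x = y \<or> i < lev x \<and> i < lev y"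
    by (auto simp: inner_collapse_def)
  note cl = c z meet_closed join_closed
  show "(x \<otimes> z, y \<otimes> z) \<in> inner_collapse i \<and> (z \<otimes> x, z \<otimes> y) \<in> inner_collapse i \<and>
      (x \<curlywedge> z, y \<curlywedge> z) \<in> inner_collapse i \<and> (x \<curlyvee> z, y \<curlyvee> z) \<in> inner_collapse i"
  proof (cases "x = y \<or> i < lev z")
    case True
    then show ?thesis
      using xy by (auto simp: inner_collapse_def cl mult_lev meet_height join_height)
  next
    case False
    then have xy: "i < lev x" "i < lev y" and lz: "lev z \<le> i" using xy by auto
    have "z \<noteq> \<one>" using lz xy lev_bounds[OF c(1)] lev_one by auto
    then consider "s z = 1" | "s z = -1" using sign_cases z by blast
    moreover have "z \<otimes> w = z \<and> w \<otimes> z = z \<and>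
        (s z = 1 \<longrightarrow> height n (lev w) (s w) < height n (lev z) (s z)) \<and>
        (s z = -1 \<longrightarrow> height n (lev z) (s z) < height n (lev w) (s w))"
      if w: "w \<in> carrier M" "i < lev w" for w
      using mult_outer[OF z w(1)] lz w lev_bounds[OF w(1)] sign_range[OF w(1)]
      by (auto simp: height_def)
    note this[OF c(1) xy(1)] this[OF c(2) xy(2)]
    ultimately show ?thesis
      using xy by cases (auto simp: inner_collapse_def cl meet_height join_height)
  qed
qed

definition pair_collapse :: "'a \<Rightarrow> 'a \<Rightarrow> ('a \<times> 'a) set" where
  "pair_collapse a b = Id_on (carrier M) \<union> {(a, b), (b, a)}"

text \<open>The elements \<open>a\<close> and \<open>b\<close> are adjacent both in the absorption preorder and in the order,
  because nothing else occupies their levels. Every other element therefore relates to both in the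
  same way.\<close>

lemma pair_collapse:
  assumes a: "a \<in> carrier M" "lev a = i" and b: "b \<in> carrier M" "lev b = Suc i"
    and signs: "signs i = {\<sigma>}" "signs (Suc i) = {\<sigma>}"
  shows "pair_collapse a b \<in> congruences M"
proof (rule congruenceI)
  show "equiv (carrier M) (pair_collapse a b)"
    using a b by (auto simp: equiv_def refl_on_def sym_def trans_def pair_collapse_def)
  have sab: "s a = \<sigma>" "s b = \<sigma>" using a b signs by (auto simp: signs_def)
  have only: "z = a" if "z \<in> carrier M" "lev z = i" for z
  proof -
    have "s z = \<sigma>" using that signs(1) by (auto simp: signs_def)
    then show ?thesis using lev_sign_inj that a sab by simp
  qed
  have only': "z = b" if "z \<in> carrier M" "lev z = Suc i" for z
  proof -
    have "s z = \<sigma>" using that signs(2) by (auto simp: signs_def)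
    then show ?thesis using lev_sign_inj that b sab by simp
  qed
  have ab: "a \<otimes> b = a" "b \<otimes> a = a" using mult_outer a b by auto
  have main: "(a \<otimes> z, b \<otimes> z) \<in> pair_collapse a b \<and> (z \<otimes> a, z \<otimes> b) \<in> pair_collapse a b \<and>
      (a \<curlywedge> z, b \<curlywedge> z) \<in> pair_collapse a b \<and> (a \<curlyvee> z, b \<curlyvee> z) \<in> pair_collapse a b"
    if z: "z \<in> carrier M" for z
  proof -
    let ?h = "\<lambda>x. height n (lev x) (s x)"
    consider "z = a" | "z = b" | "lev z < i" | "Suc i < lev z"
      using only[OF z] only'[OF z] by linarith
    then show ?thesis
    proof cases
      case 3
      have "a \<otimes> z = z" "z \<otimes> a = z" "b \<otimes> z = z" "z \<otimes> b = z"
        using mult_outer[OF z a(1)] mult_outer[OF z b(1)] 3 a b by auto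
      moreover have "z \<noteq> \<one>" using 3 a lev_bounds[OF a(1)] lev_one by auto
      then have "?h a < ?h z \<and> ?h b < ?h z \<or> ?h z < ?h a \<and> ?h z < ?h b"
        using sign_cases[OF z] sign_range[OF a(1)] 3 a b sab lev_bounds[OF b(1)]
        by (auto simp: height_def)
      ultimately show ?thesis
        using z a b by (auto simp: pair_collapse_def meet_height join_height)
    next
      case 4
      have "a \<otimes> z = a" "z \<otimes> a = a" "b \<otimes> z = b" "z \<otimes> b = b"
        using mult_outer[OF a(1) z] mult_outer[OF b(1) z] 4 a b by auto
      moreover have "b \<noteq> \<one>" using 4 b lev_bounds[OF z] lev_one by auto
      then have "?h a < ?h z \<and> ?h b < ?h z \<or> ?h z < ?h a \<and> ?h z < ?h b"
        using sign_cases[OF b(1)] sign_range[OF z] 4 a b sab lev_bounds[OF z]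
        by (auto simp: height_def)
      ultimately show ?thesis
        using z a b by (auto simp: pair_collapse_def meet_height join_height)
    qed (use a b ab in \<open>auto simp: pair_collapse_def idem meet_height join_height\<close>)
  qed
  have swap: "(y, x) \<in> pair_collapse a b" if "(x, y) \<in> pair_collapse a b" for x y
    using that by (auto simp: pair_collapse_def)
  fix x y z assume xy: "(x, y) \<in> pair_collapse a b" and z: "z \<in> carrier M"
  consider "x = y" "x \<in> carrier M" | "x = a" "y = b" | "x = b" "y = a"
    using xy by (auto simp: pair_collapse_def)
  then show "(x \<otimes> z, y \<otimes> z) \<in> pair_collapse a b \<and> (z \<otimes> x, z \<otimes> y) \<in> pair_collapse a b \<and>
      (x \<curlywedge> z, y \<curlywedge> z) \<in> pair_collapse a b \<and> (x \<curlyvee> z, y \<curlyvee> z) \<in> pair_collapse a b"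
  proof cases
    case 1
    then show ?thesis using z by (auto simp: pair_collapse_def meet_closed join_closed)
  next
    case 2 then show ?thesis using main[OF z] by simp
  next
    case 3 then show ?thesis using main[OF z] swap by simp
  qed
qed

text \<open>If two consecutive levels are the singletons \<open>{a}\<close> and \<open>{b}\<close>, with equal signs, then
  \<open>pair_collapse\<close> relates no elements but \<open>a\<close> and \<open>b\<close>, and \<open>inner_collapse\<close> at the level of \<open>a\<close>
  leaves \<open>a\<close> alone while relating \<open>b\<close> to the identity.\<close>

lemma subdirectly_irreducible_imp_alternating:
  assumes si: "subdirectly_irreducible M"
  shows alternating
  unfolding alternating_def
proof (intro ballI impI)
  fix i assume i: "i \<in> {1..n - 1}" and eq: "signs i = signs (i + 1)"
  then have i': "i \<in> {1..n}" "i + 1 \<in> {1..n}" by auto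
  show "signs i = {-1, 1}"
  proof (rule ccontr)
    assume "signs i \<noteq> {-1, 1}"
    then have "signs i = {-1} \<or> signs i = {1}"
      using signs_subset[OF i'(1)] signs_nonempty[OF i'(1)] by blast
    then obtain \<sigma> where \<sigma>: "signs i = {\<sigma>}" "signs (Suc i) = {\<sigma>}" using eq by auto
    then have "\<sigma> \<in> signs i" "\<sigma> \<in> signs (Suc i)" by auto
    then obtain a b where a: "a \<in> carrier M" "lev a = i" and b: "b \<in> carrier M" "lev b = Suc i"
      unfolding signs_def by blast
    let ?C = "{pair_collapse a b, inner_collapse i}"
    have "?C \<subseteq> congruences M" using pair_collapse[OF a b \<sigma>] inner_collapse by blast
    moreover have "x = y" if "\<forall>\<theta>\<in>?C. (x, y) \<in> \<theta>" for x y
      using that a by (auto simp: pair_collapse_def inner_collapse_def)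
    ultimately obtain \<theta> where \<theta>: "\<theta> \<in> ?C" "\<theta> \<subseteq> Id"
      by (rule subdirectly_irreducible_congruences[OF si])
    have "(a, b) \<in> pair_collapse a b" "a \<noteq> b" using a b by (auto simp: pair_collapse_def)
    moreover have "(b, \<one>) \<in> inner_collapse i" "b \<noteq> \<one>"
      using b i' lev_one by (auto simp: inner_collapse_def)
    ultimately show False using \<theta> by blast
  qed
qed

end

section \<open>Finite idempotent ordered monoids are layered\<close>

text \<open>Counting predecessors represents the preorder by numbers, possibly with gaps; replacing
  each value by its position among the values closes the gaps.\<close>

lemma finite_total_preorder_rank:
  assumes fin: "finite S"
    and total: "\<And>x y. \<lbrakk>x \<in> S; y \<in> S\<rbrakk> \<Longrightarrow> P x y \<or> P y x"
    and trans: "\<And>x y z. \<lbrakk>x \<in> S; y \<in> S; z \<in> S; P x y; P y z\<rbrakk> \<Longrightarrow> P x z"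
  shows "\<exists>(f :: 'a \<Rightarrow> nat) N. f ` S = {1..N} \<and> (\<forall>x\<in>S. \<forall>y\<in>S. P x y \<longleftrightarrow> f x \<le> f y)"
proof -
  \<comment> \<open>\<open>g\<close> counts predecessors and \<open>c\<close> closes the gaps.\<close>
  define g where "g x = card {y \<in> S. P y x}" for x
  define c where "c a = card (g ` S \<inter> {..a})" for a
  have g: "P x y \<longleftrightarrow> g x \<le> g y" if xy: "x \<in> S" "y \<in> S" for x y
  proof
    assume "P x y"
    then have "{z \<in> S. P z x} \<subseteq> {z \<in> S. P z y}" using trans xy by blast
    then show "g x \<le> g y" unfolding g_def by (intro card_mono) (simp add: fin)
  next
    assume le: "g x \<le> g y"
    show "P x y"
    proof (rule ccontr)
      assume n: "\<not> P x y"
      have "{z \<in> S. P z y} \<subseteq> {z \<in> S. P z x}" using total[OF xy] n trans xy by blast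
      moreover have "x \<in> {z \<in> S. P z x} - {z \<in> S. P z y}" using total[of x x] n xy by blast
      ultimately have "{z \<in> S. P z y} \<subset> {z \<in> S. P z x}" by blast
      then have "g y < g x" unfolding g_def by (intro psubset_card_mono) (simp add: fin)
      then show False using le by simp
    qed
  qed
  have c: "a \<le> b \<longleftrightarrow> c a \<le> c b" if ab: "a \<in> g ` S" "b \<in> g ` S" for a b
  proof
    assume "a \<le> b"
    then show "c a \<le> c b" unfolding c_def by (intro card_mono) (auto simp: fin)
  next
    assume le: "c a \<le> c b"
    show "a \<le> b"
    proof (rule ccontr)
      assume "\<not> a \<le> b"
      then have "g ` S \<inter> {..b} \<subset> g ` S \<inter> {..a}" using ab by auto
      then have "c b < c a" unfolding c_def by (intro psubset_card_mono) (simp_all add: fin)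
      then show False using le by simp
    qed
  qed
  have "c ` (g ` S) = {1..card (g ` S)}"
  proof (rule card_subset_eq)
    have "inj_on c (g ` S)"
      by (rule inj_onI) (metis c order_antisym order_refl)
    then show "card (c ` (g ` S)) = card {1..card (g ` S)}" by (simp add: card_image)
    show "c ` (g ` S) \<subseteq> {1..card (g ` S)}"
    proof
      fix m assume "m \<in> c ` (g ` S)"
      then obtain a where a: "a \<in> g ` S" "m = c a" by blast
      then have "g ` S \<inter> {..a} \<noteq> {}" by auto
      then have "0 < c a" unfolding c_def by (simp add: card_gt_0_iff fin)
      moreover have "c a \<le> card (g ` S)" unfolding c_def by (intro card_mono) (auto simp: fin)
      ultimately show "m \<in> {1..card (g ` S)}" using a by simp
    qed
  qed simp
  then have "(c \<circ> g) ` S = {1..card (g ` S)}" by (simp add: image_comp)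
  moreover have "\<forall>x\<in>S. \<forall>y\<in>S. P x y \<longleftrightarrow> (c \<circ> g) x \<le> (c \<circ> g) y" by (simp add: g c)
  ultimately show ?thesis by blast
qed

locale idempotent_chain = distributive_lmonoid M for M :: "'a lmonoid" (structure) +
  assumes total: "\<lbrakk>x \<in> carrier M; y \<in> carrier M\<rbrakk> \<Longrightarrow> lm_le M x y \<or> lm_le M y x"
    and idem: "x \<in> carrier M \<Longrightarrow> x \<otimes> x = x"
begin

abbreviation le :: "'a \<Rightarrow> 'a \<Rightarrow> bool"  (infix \<open>\<sqsubseteq>\<close> 50) where
  "x \<sqsubseteq> y \<equiv> lm_le M x y"

lemma mult_left_mono:
  "\<lbrakk>a \<in> carrier M; b \<in> carrier M; c \<in> carrier M; b \<sqsubseteq> c\<rbrakk> \<Longrightarrow> a \<otimes> b \<sqsubseteq> a \<otimes> c"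
  using mult_mono[of a b c \<one>] by simp

lemma mult_right_mono:
  "\<lbrakk>a \<in> carrier M; b \<in> carrier M; c \<in> carrier M; b \<sqsubseteq> c\<rbrakk> \<Longrightarrow> b \<otimes> a \<sqsubseteq> c \<otimes> a"
  using mult_mono[of \<one> b c a] by simp

lemma mult_negative:
  assumes c: "x \<in> carrier M" "y \<in> carrier M" and le: "x \<sqsubseteq> y" "y \<sqsubseteq> \<one>"
  shows "x \<otimes> y = x" "y \<otimes> x = x"
proof -
  have "x \<otimes> y \<sqsubseteq> x" "x \<sqsubseteq> x \<otimes> y" "y \<otimes> x \<sqsubseteq> x" "x \<sqsubseteq> y \<otimes> x"
    using mult_left_mono[of x y \<one>] mult_left_mono[of x x y]
      mult_right_mono[of x y \<one>] mult_right_mono[of x x y] c le idem by simp_all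
  then show "x \<otimes> y = x" "y \<otimes> x = x" using le_antisym c by simp_all
qed

lemma mult_positive:
  assumes c: "x \<in> carrier M" "y \<in> carrier M" and le: "\<one> \<sqsubseteq> x" "x \<sqsubseteq> y"
  shows "x \<otimes> y = y" "y \<otimes> x = y"
proof -
  have "x \<otimes> y \<sqsubseteq> y" "y \<sqsubseteq> x \<otimes> y" "y \<otimes> x \<sqsubseteq> y" "y \<sqsubseteq> y \<otimes> x"
    using mult_left_mono[of y x y] mult_left_mono[of y \<one> x]
      mult_right_mono[of y x y] mult_right_mono[of y \<one> x] c le idem by simp_all
  then show "x \<otimes> y = y" "y \<otimes> x = y" using le_antisym c by simp_all
qed

text \<open>Both products lie between \<open>x\<close> and \<open>y\<close>. If such a product is at most \<open>e\<close>, multiplying this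
  inequality once more by \<open>x\<close> shows that it is at most \<open>x\<close>; if it is at least \<open>e\<close>, multiplying
  by \<open>y\<close> shows that it is at least \<open>y\<close>.\<close>

lemma mult_mixed:
  assumes c: "x \<in> carrier M" "y \<in> carrier M" and le: "x \<sqsubseteq> \<one>" "\<one> \<sqsubseteq> y"
  shows "x \<otimes> y = x \<or> x \<otimes> y = y" "y \<otimes> x = x \<or> y \<otimes> x = y"
proof -
  have i: "x \<otimes> (x \<otimes> y) = x \<otimes> y" "(y \<otimes> x) \<otimes> x = y \<otimes> x" "(x \<otimes> y) \<otimes> y = x \<otimes> y" "y \<otimes> (y \<otimes> x) = y \<otimes> x"
    using c idem by (simp_all add: m_assoc flip: m_assoc[of x x y] m_assoc[of y y x])
  have b: "x \<sqsubseteq> x \<otimes> y" "x \<sqsubseteq> y \<otimes> x" "x \<otimes> y \<sqsubseteq> y" "y \<otimes> x \<sqsubseteq> y"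
    using mult_left_mono[of x \<one> y] mult_right_mono[of x \<one> y]
      mult_right_mono[of y x \<one>] mult_left_mono[of y x \<one>] c le by simp_all
  show "x \<otimes> y = x \<or> x \<otimes> y = y"
  proof (cases "x \<otimes> y \<sqsubseteq> \<one>")
    case True
    then have "x \<otimes> y \<sqsubseteq> x" using mult_left_mono[of x "x \<otimes> y" \<one>] c i by simp
    then show ?thesis using le_antisym b c by simp
  next
    case False
    then have "\<one> \<sqsubseteq> x \<otimes> y" using total c by blast
    then have "y \<sqsubseteq> x \<otimes> y" using mult_right_mono[of y \<one> "x \<otimes> y"] c i by simp
    then show ?thesis using le_antisym b c by simp
  qed
  show "y \<otimes> x = x \<or> y \<otimes> x = y"
  proof (cases "y \<otimes> x \<sqsubseteq> \<one>")
    case True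
    then have "y \<otimes> x \<sqsubseteq> x" using mult_right_mono[of x "y \<otimes> x" \<one>] c i by simp
    then show ?thesis using le_antisym b c by simp
  next
    case False
    then have "\<one> \<sqsubseteq> y \<otimes> x" using total c by blast
    then have "y \<sqsubseteq> y \<otimes> x" using mult_left_mono[of y \<one> "y \<otimes> x"] c i by simp
    then show ?thesis using le_antisym b c by simp
  qed
qed

lemma mult_conservative:
  assumes c: "x \<in> carrier M" "y \<in> carrier M"
  shows "x \<otimes> y = x \<or> x \<otimes> y = y"
proof -
  have "x \<sqsubseteq> \<one> \<or> \<one> \<sqsubseteq> x" "y \<sqsubseteq> \<one> \<or> \<one> \<sqsubseteq> y" "x \<sqsubseteq> y \<or> y \<sqsubseteq> x" using total c by simp_all
  then show ?thesis
    using mult_negative[OF c] mult_negative[OF c(2,1)] mult_positive[OF c]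
      mult_positive[OF c(2,1)] mult_mixed(1)[OF c] mult_mixed(2)[OF c(2,1)] by blast
qed

text \<open>The \<open>J\<close>-preorder of the band; smaller elements are the stronger ones in products.\<close>

definition absorbs :: "'a \<Rightarrow> 'a \<Rightarrow> bool" where
  "absorbs x y \<longleftrightarrow> x \<otimes> y \<otimes> x = x"

lemma absorbsI:
  assumes "x \<in> carrier M" "y \<in> carrier M" "x \<otimes> y = x \<or> y \<otimes> x = x"
  shows "absorbs x y"
proof -
  have "x \<otimes> y \<otimes> x = x \<otimes> (y \<otimes> x)" using assms by (simp add: m_assoc)
  then show ?thesis using assms idem by (auto simp: absorbs_def)
qed

lemma absorbs_total: "\<lbrakk>x \<in> carrier M; y \<in> carrier M\<rbrakk> \<Longrightarrow> absorbs x y \<or> absorbs y x"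
  using absorbsI mult_conservative by blast

lemma absorbs_iff:
  assumes "x \<in> carrier M" "y \<in> carrier M"
  shows "absorbs x y \<longleftrightarrow> x \<otimes> y = x \<or> y \<otimes> x = x"
  using absorbsI[OF assms] mult_conservative[OF assms] by (auto simp: absorbs_def)

lemma absorbs_trans:
  assumes c: "x \<in> carrier M" "y \<in> carrier M" "z \<in> carrier M"
    and xy: "absorbs x y" and yz: "absorbs y z"
  shows "absorbs x z"
proof (rule ccontr)
  assume n: "\<not> absorbs x z"
  then have z: "x \<otimes> z = z" "z \<otimes> x = z" "z \<noteq> x"
    using mult_conservative[of x z] mult_conservative[of z x] absorbs_iff[of x z] c by auto
  have "y \<otimes> z = y \<or> z \<otimes> y = y" "x \<otimes> y = x \<or> y \<otimes> x = x" using xy yz c absorbs_iff by auto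
  then have "x \<otimes> z = x \<or> z \<otimes> x = x"
    using z c mult_conservative[of x y] mult_conservative[of y x]
      m_assoc[of x y z] m_assoc[of z y x] m_assoc[of y z x] m_assoc[of x z y] 
      m_assoc[of z x y] m_assoc[of y x z]
    by metis
  then show False using z by metis
qed

lemma absorbs_strict:
  assumes c: "x \<in> carrier M" "y \<in> carrier M" and n: "\<not> absorbs y x"
  shows "x \<otimes> y = x \<and> y \<otimes> x = x"
  using n absorbs_iff[OF c(2,1)] mult_conservative[OF c] mult_conservative[OF c(2,1)] by auto

text \<open>Elements that absorb each other form a left-zero or a right-zero band; these two cases
  are the origin of \<open>G3\<close> and \<open>D3\<close>.\<close>

lemma absorbs_both:
  assumes c: "x \<in> carrier M" "y \<in> carrier M" and b: "absorbs x y" "absorbs y x"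
  shows "x \<otimes> y = x \<and> y \<otimes> x = y \<or> x \<otimes> y = y \<and> y \<otimes> x = x"
  using b absorbs_iff[OF c] absorbs_iff[OF c(2,1)]
    mult_conservative[OF c] mult_conservative[OF c(2,1)]
  by (cases "x = y") (auto simp: absorbs_def)

text \<open>The level is the rank in the absorption preorder, in which \<open>e\<close> is the unique greatest
  element, and the sign says on which side of \<open>e\<close> an element lies. The product of two elements
  of equal sign is the one further from \<open>e\<close>; so they absorb each other only if they are equal,
  and on each side the absorption preorder agrees with the distance from \<open>e\<close>.\<close>

lemma finite_imp_layered:
  assumes fin: "finite (carrier M)"
  obtains n lev s where "layered_lmonoid M n lev s"
proof -
  have "\<exists>(f :: 'a \<Rightarrow> nat) N. f ` carrier M = {1..N} \<and>
      (\<forall>x\<in>carrier M. \<forall>y\<in>carrier M. absorbs x y \<longleftrightarrow> f x \<le> f y)"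
    using fin absorbs_total absorbs_trans by (rule finite_total_preorder_rank)
  then obtain lev :: "'a \<Rightarrow> nat" and N where img: "lev ` carrier M = {1..N}"
    and "\<forall>x\<in>carrier M. \<forall>y\<in>carrier M. absorbs x y \<longleftrightarrow> lev x \<le> lev y"
    by blast
  then have lev: "absorbs x y \<longleftrightarrow> lev x \<le> lev y" if "x \<in> carrier M" "y \<in> carrier M" for x y
    using that by blast
  have abs_one: "absorbs x \<one>" if "x \<in> carrier M" for x
    using that idem by (simp add: absorbs_def)
  have one_abs: "x = \<one>" if "x \<in> carrier M" "absorbs \<one> x" for x
    using that by (simp add: absorbs_def)
  define n where "n = N - 1"
  have "lev \<one> \<in> {1..N}" using img one_closed by blast
  then have N: "N = Suc n" and "N \<in> lev ` carrier M" using img by (auto simp: n_def)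
  then obtain x where x: "x \<in> carrier M" "lev x = N" by auto
  have lev_one: "lev \<one> = Suc n"
    using lev[OF x(1) one_closed] abs_one[OF x(1)] x(2) N \<open>lev \<one> \<in> {1..N}\<close> by simp
  have lev_le: "1 \<le> lev x \<and> lev x \<le> Suc n" if "x \<in> carrier M" for x
  proof -
    have "lev x \<in> {1..Suc n}" using img N that by blast
    then show ?thesis by simp
  qed
  have lev_one_iff: "lev x = Suc n \<longleftrightarrow> x = \<one>" if "x \<in> carrier M" for x
    using one_abs[OF that] lev[OF one_closed that] lev_one by auto
  have lev_less: "lev x \<le> n" if "x \<in> carrier M" "x \<noteq> \<one>" for x
    using lev_one_iff[OF that(1)] lev_le[OF that(1)] that(2) by auto
  define s where "s x = (if x = \<one> then 0 else if x \<sqsubseteq> \<one> then -1 else 1 :: int)" for x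
  have same: "x = y" if c: "x \<in> carrier M" "y \<in> carrier M" "lev x = lev y" "s x = s y" for x y
  proof (cases "x = \<one> \<or> y = \<one>")
    case True
    then show ?thesis using c lev_one_iff by metis
  next
    case False
    have "absorbs x y" "absorbs y x" using lev c by simp_all
    note b = absorbs_both[OF c(1,2) this]
    have "x \<sqsubseteq> \<one> \<and> y \<sqsubseteq> \<one> \<or> \<one> \<sqsubseteq> x \<and> \<one> \<sqsubseteq> y"
      using False c(4) total[OF c(1) one_closed] total[OF c(2) one_closed]
      by (auto simp: s_def split: if_splits)
    then show ?thesis
      using b total[OF c(1,2)] mult_negative[OF c(1,2)] mult_negative[OF c(2,1)]
        mult_positive[OF c(1,2)] mult_positive[OF c(2,1)] by metis
  qed
  let ?h = "\<lambda>x. height n (lev x) (s x)"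
  have hinj: "x = y" if c: "x \<in> carrier M" "y \<in> carrier M" "?h x = ?h y" for x y
  proof (cases "x = \<one> \<or> y = \<one>")
    case True
    have "?h z = 0 \<longleftrightarrow> z = \<one>" if "z \<in> carrier M" for z
      using lev_one_iff[OF that] by (auto simp: height_def s_def)
    then show ?thesis using True c by (metis one_closed)
  next
    case False
    then have "lev x \<le> n" "lev y \<le> n" using lev_less c by simp_all
    then show ?thesis
      using c False same[of x y] by (auto simp: height_def s_def split: if_splits)
  qed
  have hmono: "?h x \<le> ?h y" if c: "x \<in> carrier M" "y \<in> carrier M" and le: "x \<sqsubseteq> y" for x y
  proof -
    note b = lev_le[OF c(1)] lev_le[OF c(2)]
    consider "y \<sqsubseteq> \<one>" | "\<not> y \<sqsubseteq> \<one>" "x \<sqsubseteq> \<one>" | "\<not> x \<sqsubseteq> \<one>" "\<not> y \<sqsubseteq> \<one>" by blast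
    then show ?thesis
    proof cases
      case 1
      have x1: "x \<sqsubseteq> \<one>" using le_trans[OF c one_closed le 1] .
      have "lev x \<le> lev y"
        using absorbsI[OF c] mult_negative[OF c le 1] lev c by simp
      moreover have "y = \<one>" if "x = \<one>" using le_antisym[OF c(2) one_closed 1] le that by simp
      ultimately show ?thesis using 1 x1 b by (auto simp: height_def s_def)
    next
      case 2
      then show ?thesis using b by (auto simp: height_def s_def)
    next
      case 3
      then have "\<one> \<sqsubseteq> x" using total c by blast
      then have "lev y \<le> lev x"
        using absorbsI[OF c(2,1)] mult_positive[OF c _ le] lev c by simp
      then show ?thesis using 3 le_refl by (auto simp: height_def s_def)
    qed
  qed
  have h: "x \<sqsubseteq> y \<longleftrightarrow> ?h x \<le> ?h y" if c: "x \<in> carrier M" "y \<in> carrier M" for x y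
    using hmono[OF c] hmono[OF c(2,1)] hinj[OF c] total[OF c] le_refl[OF c(1)]
    by (metis order_antisym)
  have "layered_lmonoid M n lev s"
  proof unfold_locales
    show "lev ` carrier M = {1..Suc n}" using img N by simp
    fix x assume x: "x \<in> carrier M"
    show "s x \<in> {- 1, 0, 1}" "s x = 0 \<longleftrightarrow> x = \<one>" by (auto simp: s_def)
    show "lev x = Suc n \<longleftrightarrow> x = \<one>" "x \<otimes> x = x" using lev_one_iff idem x by simp_all
    fix y assume y: "y \<in> carrier M"
    show "lev x < lev y \<Longrightarrow> x \<otimes> y = x \<and> y \<otimes> x = x"
      using absorbs_strict x y lev by simp
    show "lev x = lev y \<Longrightarrow> x \<noteq> y \<Longrightarrow> x \<otimes> y = x \<and> y \<otimes> x = y \<or> x \<otimes> y = y \<and> y \<otimes> x = x"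
      using absorbs_both x y lev by simp
    show "lev x = lev y \<Longrightarrow> s x = s y \<Longrightarrow> x = y" using same x y by simp
    show "x \<curlywedge> y = (if ?h x \<le> ?h y then x else y)"
      using h[OF x y] total[OF x y] meet_comm[OF x y] by (auto simp: lm_le_def)
    show "x \<curlyvee> y = (if ?h x \<le> ?h y then y else x)"
      using h[OF x y] total[OF x y] join_comm[OF x y] le_iff_join x y by auto
  qed
  then show thesis by (rule that)
qed

end

section \<open>Nested sums of the four algebras\<close>

text \<open>Taking the number \<open>n\<close> of levels as a parameter, and not from the summation bound, makes the
  heights of a partial sum the same as those of the full sum.\<close>

definition nested_height :: "nat \<Rightarrow> (nat \<times> int) option \<Rightarrow> int" where
  "nested_height n a = (case a of None \<Rightarrow> 0 | Some (i, x) \<Rightarrow> height n i x)"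

definition nested_mult ::
    "(nat \<Rightarrow> int lmonoid) \<Rightarrow> (nat \<times> int) option \<Rightarrow> (nat \<times> int) option \<Rightarrow> (nat \<times> int) option" where
  "nested_mult Ms a b = (case a of None \<Rightarrow> b | Some (i, x) \<Rightarrow>
     (case b of None \<Rightarrow> a | Some (j, y) \<Rightarrow>
       if i < j then a else if j < i then b else Some (i, x \<otimes>\<^bsub>Ms i\<^esub> y)))"

lemma summand_facts:
  assumes "N \<in> {C2, C2d, G3, D3}"
  shows "carrier N \<subseteq> {-1, 0, 1}" "0 \<in> carrier N" "carrier N - {0} \<noteq> {}"
    "\<one>\<^bsub>N\<^esub> = 0" "lmeet N = min" "ljoin N = max"
    "\<lbrakk>x \<in> carrier N; y \<in> carrier N\<rbrakk> \<Longrightarrow> x \<otimes>\<^bsub>N\<^esub> y \<in> carrier N"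
    "\<lbrakk>x \<in> carrier N; x \<noteq> 0; y \<in> carrier N; y \<noteq> 0\<rbrakk> \<Longrightarrow> x \<otimes>\<^bsub>N\<^esub> y \<noteq> 0"
    "x \<in> carrier N \<Longrightarrow> x \<otimes>\<^bsub>N\<^esub> 0 = x" "x \<in> carrier N \<Longrightarrow> 0 \<otimes>\<^bsub>N\<^esub> x = x"
    "x \<in> carrier N \<Longrightarrow> x \<otimes>\<^bsub>N\<^esub> x = x"
    "\<lbrakk>x \<in> carrier N; x \<noteq> 0; y \<in> carrier N; y \<noteq> 0; x \<noteq> y\<rbrakk> \<Longrightarrow>
      x \<otimes>\<^bsub>N\<^esub> y = x \<and> y \<otimes>\<^bsub>N\<^esub> x = y \<or> x \<otimes>\<^bsub>N\<^esub> y = y \<and> y \<otimes>\<^bsub>N\<^esub> x = x"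
  using assms by (auto simp: C2_def C2d_def G3_def D3_def)

text \<open>For a summand at level \<open>i\<close> the height multiplies the integer order of the summand by the
  positive constant \<open>n + 1 - i\<close>.\<close>

lemma tagged_copy_summand:
  assumes N: "N \<in> {C2, C2d, G3, D3}" and ni: "i \<le> n"
  defines "P \<equiv> tagged_copy i N"
  shows "carrier P = insert None ((\<lambda>z. Some (i, z)) ` (carrier N - {0}))"
    and "\<lbrakk>a \<in> carrier P; b \<in> carrier P\<rbrakk> \<Longrightarrow> a \<otimes>\<^bsub>P\<^esub> b = nested_mult (\<lambda>_. N) a b"
    and "\<lbrakk>a \<in> carrier P; b \<in> carrier P\<rbrakk> \<Longrightarrow> lm_le P a b \<longleftrightarrow> nested_height n a \<le> nested_height n b"
proof -
  define t where "t z = (if z = 0 then None else Some (i, z))" for z :: int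
  note fct = summand_facts[OF N]
  have P: "P = lm_image t N" unfolding P_def tagged_copy_def fct(4) t_def ..
  have inj: "inj_on t (carrier N)" by (auto simp: inj_on_def t_def)
  note sm = lm_image_simps[OF inj]
  have eqt: "t x = t y \<longleftrightarrow> x = y" for x y by (auto simp: t_def)
  have ht: "nested_height n (t z) = z * (int (Suc n) - int i)" for z
    by (simp add: t_def nested_height_def height_def)
  show "carrier P = insert None ((\<lambda>z. Some (i, z)) ` (carrier N - {0}))"
    unfolding P sm(1) using fct(2) by (auto simp: t_def image_iff)
  assume "a \<in> carrier P" "b \<in> carrier P"
  then obtain x y where xy: "x \<in> carrier N" "y \<in> carrier N" "a = t x" "b = t y"
    unfolding P sm(1) by blast
  show "a \<otimes>\<^bsub>P\<^esub> b = nested_mult (\<lambda>_. N) a b"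
    using xy fct(7-10) unfolding P xy(3,4) sm(3)[OF xy(1,2)]
    by (auto simp: t_def nested_mult_def)
  have "lm_le P a b \<longleftrightarrow> x \<le> y"
    unfolding lm_le_def P xy(3,4) sm(4)[OF xy(1,2)] fct(5) eqt by auto
  also have "\<dots> \<longleftrightarrow> nested_height n a \<le> nested_height n b"
    unfolding xy(3,4) ht using ni by (simp add: mult_le_cancel_right)
  finally show "lm_le P a b \<longleftrightarrow> nested_height n a \<le> nested_height n b" .
qed

text \<open>The height is an order embedding into the integers: an element of an earlier summand has a
  greater absolute height than all elements of later ones, which places the later summands between
  the negative and the positive elements of the earlier ones, as \<open>nested_order\<close> demands.\<close>

lemma big_nested_sum_description:
  assumes "\<forall>i\<in>{1..m}. Ms i \<in> {C2, C2d, G3, D3}" "m \<le> n"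
  defines "B \<equiv> big_nested_sum m Ms"
  shows "carrier B = insert None {Some (i, z) | i z. i \<in> {1..m} \<and> z \<in> carrier (Ms i) - {0}} \<and>
    \<one>\<^bsub>B\<^esub> = None \<and>
    (\<forall>a\<in>carrier B. \<forall>b\<in>carrier B. a \<otimes>\<^bsub>B\<^esub> b = nested_mult Ms a b \<and>
      a \<curlywedge>\<^bsub>B\<^esub> b = (if nested_height n a \<le> nested_height n b then a else b) \<and>
      a \<curlyvee>\<^bsub>B\<^esub> b = (if nested_height n a \<le> nested_height n b then b else a))"
  using assms(1,2) unfolding B_def
proof (induction m)
  case 0
  then show ?case by (auto simp: trivial_lm_def nested_mult_def)
next
  case (Suc m)
  define B where "B = big_nested_sum m Ms"
  define N where "N = Ms (Suc m)"
  define P where "P = tagged_copy (Suc m) N"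
  let ?h = "nested_height n"
  have N: "N \<in> {C2, C2d, G3, D3}" using Suc.prems by (simp add: N_def)
  note fct = summand_facts[OF N]
  note P = tagged_copy_summand[OF N Suc.prems(2), folded P_def]
  have B: "a \<otimes>\<^bsub>B\<^esub> b = nested_mult Ms a b" "a \<curlywedge>\<^bsub>B\<^esub> b = (if ?h a \<le> ?h b then a else b)"
      "a \<curlyvee>\<^bsub>B\<^esub> b = (if ?h a \<le> ?h b then b else a)"
    if "a \<in> carrier B" "b \<in> carrier B" for a b
    using Suc.IH Suc.prems that by (simp_all add: B_def)
  have IH: "carrier B = insert None {Some (i, z) | i z. i \<in> {1..m} \<and> z \<in> carrier (Ms i) - {0}}"
    "\<one>\<^bsub>B\<^esub> = None"
    using Suc.IH Suc.prems by (simp_all add: B_def)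
  have NB: "None \<in> carrier B" "None \<in> carrier P" using IH P(1) by auto
  have leB: "lm_le B a b \<longleftrightarrow> ?h a \<le> ?h b" if "a \<in> carrier B" "b \<in> carrier B" for a b
    using B(2)[OF that] by (auto simp: lm_le_def)
  have h0: "?h None = 0" by (simp add: nested_height_def)
  have inter: "a = None" if "a \<in> carrier B" "a \<in> carrier P" for a
    using that unfolding IH P(1) by auto
  \<comment> \<open>The heights in the new summand are bounded by \<open>n - m\<close>, those of the earlier elements are at
    least \<open>n + 1 - m\<close> in absolute value.\<close>
  have cross: "(?h a \<le> 0 \<longleftrightarrow> ?h a < ?h b) \<and> (0 \<le> ?h a \<longleftrightarrow> ?h b < ?h a)"
    if a: "a \<in> carrier B" "a \<noteq> None" and b: "b \<in> carrier P" for a b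
  proof -
    obtain i z where iz: "a = Some (i, z)" "i \<in> {1..m}" "z \<in> carrier (Ms i) - {0}"
      using a IH by auto
    then have "Ms i \<in> {C2, C2d, G3, D3}" using Suc.prems by simp
    then have z: "z = 1 \<or> z = -1" using summand_facts(1) iz(3) by blast
    have "\<bar>?h b\<bar> \<le> int n - int m"
      using b fct(1) Suc.prems(2) unfolding P(1) by (auto simp: nested_height_def height_def)
    moreover have "?h a = z * (int n + 1 - int i)"
      by (simp add: iz(1) nested_height_def height_def)
    ultimately show ?thesis using z iz(2) by auto
  qed
  have order: "(a, b) \<in> nested_order B P \<longleftrightarrow> ?h a \<le> ?h b"
    if ab: "a \<in> carrier B \<union> carrier P" "b \<in> carrier B \<union> carrier P" for a b
  proof -
    consider "a \<in> carrier B" "b \<in> carrier B" | "a \<in> carrier P" "b \<in> carrier P"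
      | "a \<in> carrier B" "a \<notin> carrier P" "b \<in> carrier P" "b \<notin> carrier B"
      | "b \<in> carrier B" "b \<notin> carrier P" "a \<in> carrier P" "a \<notin> carrier B"
      using ab by blast
    then show ?thesis
    proof cases
      case 1
      then show ?thesis
        using leB[OF 1] leB[of a None] leB[of None b] P(3)[of a b] inter NB h0
        by (auto simp: nested_order_def IH(2))
    next
      case 2
      then show ?thesis
        using leB[of a b] P(3)[OF 2] inter by (auto simp: nested_order_def IH(2))
    next
      case 3
      then have "a \<noteq> None" using NB by metis
      with 3 show ?thesis
        using leB[of a None] cross[of a b] NB h0 by (auto simp: nested_order_def IH(2))
    next
      case 4
      then have "b \<noteq> None" using NB by metis
      with 4 show ?thesis
        using leB[of None b] cross[of b a] NB h0 by (auto simp: nested_order_def IH(2))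
    qed
  qed
  have S: "big_nested_sum (Suc m) Ms = B \<boxplus> P" by (simp add: B_def P_def N_def)
  have carr: "carrier (B \<boxplus> P) = carrier B \<union> carrier P" by (simp add: nested_sum_def)
  have mlt: "a \<otimes>\<^bsub>B \<boxplus> P\<^esub> b = nested_mult Ms a b"
    if ab: "a \<in> carrier B \<union> carrier P" "b \<in> carrier B \<union> carrier P" for a b
  proof -
    have eqP: "nested_mult (\<lambda>_. N) a b = nested_mult Ms a b" if "a \<in> carrier P" "b \<in> carrier P"
      using that unfolding P(1) by (auto simp: nested_mult_def N_def)
    consider "a \<in> carrier B" "b \<in> carrier B" | "a \<in> carrier P" "b \<in> carrier P"
        "\<not> (a \<in> carrier B \<and> b \<in> carrier B)"
      | "a \<in> carrier B" "a \<notin> carrier P" "b \<in> carrier P" "b \<notin> carrier B"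
      | "b \<in> carrier B" "b \<notin> carrier P" "a \<in> carrier P" "a \<notin> carrier B"
      using ab by blast
    then show ?thesis
    proof cases
      case 1 then show ?thesis by (simp add: nested_sum_def B)
    next
      case 2 then show ?thesis using eqP P(2)[OF 2(1,2)] by (auto simp: nested_sum_def)
    next
      case 3
      then show ?thesis unfolding IH(1) P(1) by (auto simp: nested_sum_def nested_mult_def IH(1) P(1))
    next
      case 4
      then show ?thesis unfolding IH(1) P(1) by (auto simp: nested_sum_def nested_mult_def IH(1) P(1))
    qed
  qed
  have "carrier B \<union> carrier P =
      insert None {Some (i, z) | i z. i \<in> {1..Suc m} \<and> z \<in> carrier (Ms i) - {0}}"
    unfolding IH(1) P(1) N_def by (auto simp: le_Suc_eq)
  then show ?case
    unfolding S carr using mlt order IH(2) by (simp add: nested_sum_def)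
qed

text \<open>Level and sign are the tag and the integer in the image of an element under the
  isomorphism.\<close>

lemma isomorphic_nested_sum_imp_layered:
  fixes M :: "'a lmonoid" (structure)
  assumes M: "distributive_lmonoid M" and idem: "idempotent_lm M"
    and Ms: "\<forall>i\<in>{1..n}. Ms i \<in> {C2, C2d, G3, D3}"
    and iso: "lm_isomorphic M (big_nested_sum n Ms)"
  obtains lev s where "layered_lmonoid M n lev s"
    "\<And>i. i \<in> {1..n} \<Longrightarrow> s ` {x \<in> carrier M. lev x = i} = carrier (Ms i) - {0}"
proof -
  interpret distributive_lmonoid M by fact
  let ?B = "big_nested_sum n Ms"
  obtain h where hom: "h \<in> lm_hom M ?B" and bij: "bij_betw h (carrier M) (carrier ?B)"
    using iso by (auto simp: lm_isomorphic_def lm_iso_def)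
  note B = big_nested_sum_description[OF Ms order_refl]
  have fct: "z = 1 \<or> z = -1" if "i \<in> {1..n}" "z \<in> carrier (Ms i) - {0}" for i z
    using summand_facts(1)[of "Ms i"] Ms that by blast
  have hB: "h x \<in> carrier ?B" if "x \<in> carrier M" for x using bij that by (auto simp: bij_betw_def)
  have hc: "h x = None \<or> (\<exists>i z. h x = Some (i, z) \<and> i \<in> {1..n} \<and> z \<in> carrier (Ms i) - {0})"
    if "x \<in> carrier M" for x using hB[OF that] B by auto
  have inj: "h x = h y \<longleftrightarrow> x = y" if "x \<in> carrier M" "y \<in> carrier M" for x y
    using bij that by (auto simp: bij_betw_def dest: inj_onD)
  have surj: "\<exists>x\<in>carrier M. h x = b" if "b \<in> carrier ?B" for b
    using bij that by (metis bij_betw_imp_surj_on imageE)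
  have h1: "h x = None \<longleftrightarrow> x = \<one>" if "x \<in> carrier M" for x
    using hom B inj[OF that one_closed] by (simp add: lm_hom_def)
  have hm: "h (x \<otimes> y) = nested_mult Ms (h x) (h y)"
    "h (x \<curlywedge> y) = (if nested_height n (h x) \<le> nested_height n (h y) then h x else h y)"
    "h (x \<curlyvee> y) = (if nested_height n (h x) \<le> nested_height n (h y) then h y else h x)"
    if "x \<in> carrier M" "y \<in> carrier M" for x y
    using hom B hB that by (simp_all add: lm_hom_def hom_def)
  define lev where "lev x = (case h x of None \<Rightarrow> Suc n | Some (i, z) \<Rightarrow> i)" for x
  define s where "s x = (case h x of None \<Rightarrow> 0 | Some (i, z) \<Rightarrow> z)" for x
  have ht: "nested_height n (h x) = height n (lev x) (s x)" for x
    by (simp add: nested_height_def height_def lev_def s_def split: option.split)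
  have signs: "s ` {x \<in> carrier M. lev x = i} = carrier (Ms i) - {0}" if i: "i \<in> {1..n}" for i
  proof
    show "s ` {x \<in> carrier M. lev x = i} \<subseteq> carrier (Ms i) - {0}"
      using hc i by (fastforce simp: lev_def s_def)
    show "carrier (Ms i) - {0} \<subseteq> s ` {x \<in> carrier M. lev x = i}"
    proof
      fix z assume "z \<in> carrier (Ms i) - {0}"
      then obtain x where "x \<in> carrier M" "h x = Some (i, z)" using surj[of "Some (i, z)"] B i by auto
      then show "z \<in> s ` {x \<in> carrier M. lev x = i}" by (force simp: lev_def s_def)
    qed
  qed
  have "layered_lmonoid M n lev s"
  proof unfold_locales
    show "lev ` carrier M = {1..Suc n}"
    proof
      show "lev ` carrier M \<subseteq> {1..Suc n}" using hc by (fastforce simp: lev_def)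
      show "{1..Suc n} \<subseteq> lev ` carrier M"
      proof
        fix i assume i: "i \<in> {1..Suc n}"
        show "i \<in> lev ` carrier M"
        proof (cases "i = Suc n")
          case True
          then show ?thesis using h1[OF one_closed] by (force simp: lev_def)
        next
          case False
          then have "i \<in> {1..n}" using i by auto
          then show ?thesis using signs[of i] summand_facts(3)[of "Ms i"] Ms by blast
        qed
      qed
    qed
    fix x assume x: "x \<in> carrier M"
    consider "h x = None" | i z where "h x = Some (i, z)" "i \<in> {1..n}" "z \<in> carrier (Ms i) - {0}"
      using hc[OF x] by metis
    then show "s x \<in> {- 1, 0, 1}"
    proof cases
      case 2 then show ?thesis using fct[OF 2(2,3)] by (auto simp: s_def)
    qed (simp add: s_def)
    show "s x = 0 \<longleftrightarrow> x = \<one>" using hc[OF x] h1[OF x] by (auto simp: s_def)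
    show "lev x = Suc n \<longleftrightarrow> x = \<one>" using hc[OF x] h1[OF x] by (auto simp: lev_def)
    show "x \<otimes> x = x" using idem x by (simp add: idempotent_lm_def)
    fix y assume y: "y \<in> carrier M"
    note cl = x y inj m_closed meet_closed join_closed
    show "lev x = lev y \<Longrightarrow> s x = s y \<Longrightarrow> x = y"
      using hc[OF x] hc[OF y] inj[OF x y] by (auto simp: lev_def s_def)
    show "x \<otimes> y = x \<and> y \<otimes> x = x" if "lev x < lev y"
    proof -
      have "h (x \<otimes> y) = h x" "h (y \<otimes> x) = h x"
        using that hc[OF x] hc[OF y] by (auto simp: lev_def hm x y nested_mult_def)
      then show ?thesis by (simp add: cl)
    qed
    show "x \<otimes> y = x \<and> y \<otimes> x = y \<or> x \<otimes> y = y \<and> y \<otimes> x = x" if l: "lev x = lev y" "x \<noteq> y"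
    proof -
      have "h x \<noteq> h y" using inj x y l by simp
      then obtain i z w where zw: "h x = Some (i, z)" "h y = Some (i, w)" "i \<in> {1..n}"
        "z \<in> carrier (Ms i) - {0}" "w \<in> carrier (Ms i) - {0}" "z \<noteq> w"
        using l(1) hc[OF x] hc[OF y] by (auto simp: lev_def)
      have "Ms i \<in> {C2, C2d, G3, D3}" using Ms zw(3) by blast
      from summand_facts(12)[OF this, of z w]
      have "h (x \<otimes> y) = h x \<and> h (y \<otimes> x) = h y \<or> h (x \<otimes> y) = h y \<and> h (y \<otimes> x) = h x"
        using zw by (auto simp: hm x y nested_mult_def)
      then show ?thesis by (simp add: cl)
    qed
    have "h (x \<curlywedge> y) = h (if height n (lev x) (s x) \<le> height n (lev y) (s y) then x else y)"
      by (simp add: hm x y ht)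
    then show "x \<curlywedge> y = (if height n (lev x) (s x) \<le> height n (lev y) (s y) then x else y)"
      by (simp add: cl split: if_splits)
    have "h (x \<curlyvee> y) = h (if height n (lev x) (s x) \<le> height n (lev y) (s y) then y else x)"
      by (simp add: hm x y ht)
    then show "x \<curlyvee> y = (if height n (lev x) (s x) \<le> height n (lev y) (s y) then y else x)"
      by (simp add: cl split: if_splits)
  qed
  then show thesis using signs by (rule that)
qed

lemma alternating_summands:
  assumes "N \<in> {C2, C2d, G3, D3}" "N' \<in> {C2, C2d, G3, D3}"
  shows "(carrier N - {0} = carrier N' - {0} \<longrightarrow> carrier N - {0} = {-1, 1}) \<longleftrightarrow>
    (N = N' \<longrightarrow> N \<in> {G3, D3})"
proof -
  have c: "carrier C2 - {0} = {-1}" "carrier C2d - {0} = {1}"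
    "carrier G3 - {0} = {-1, 1}" "carrier D3 - {0} = {-1, 1}"
    by (auto simp: C2_def C2d_def G3_def D3_def)
  have d: "C2 \<noteq> C2d" "C2 \<noteq> G3" "C2 \<noteq> D3" "C2d \<noteq> G3" "C2d \<noteq> D3" "G3 \<noteq> D3"
    using four_algebras_distinct by auto
  show ?thesis
    using assms by (elim insertE emptyE; simp add: c d d[symmetric] doubleton_eq_iff)
qed

context layered_lmonoid
begin

text \<open>A two-element level is \<open>G3\<close> or \<open>D3\<close> according to whether its multiplication is a left-zero or
  a right-zero band; one product of distinct elements decides this.\<close>

definition summand :: "nat \<Rightarrow> int lmonoid" where
  "summand i = (if signs i = {-1} then C2 else if signs i = {1} then C2d
     else if \<exists>x\<in>carrier M. \<exists>y\<in>carrier M.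
       lev x = i \<and> lev y = i \<and> x \<noteq> y \<and> x \<otimes> y = x then G3 else D3)"

lemma summand_in: "summand i \<in> {C2, C2d, G3, D3}"
  by (simp add: summand_def)

lemma carrier_summand: "i \<in> {1..n} \<Longrightarrow> carrier (summand i) - {0} = signs i"
proof -
  assume "i \<in> {1..n}"
  then consider "signs i = {-1}" | "signs i = {1}" | "signs i = {-1, 1}"
    using signs_subset[of i] signs_nonempty[of i] by blast
  then show ?thesis
    by cases (simp_all add: summand_def C2_def C2d_def G3_def D3_def doubleton_eq_iff insert_Diff_if)
qed

text \<open>Only a two-element level, where \<open>x\<close> and \<open>y\<close> are the only elements, needs an argument.\<close>

lemma mult_summand:
  assumes xy: "x \<in> carrier M" "y \<in> carrier M" "lev x = i" "lev y = i" "i \<in> {1..n}"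
  shows "s (x \<otimes> y) = s x \<otimes>\<^bsub>summand i\<^esub> s y"
proof (cases "x = y")
  case True
  have "s x \<in> carrier (summand i)" using carrier_summand[OF xy(5)] xy by (auto simp: signs_def)
  then show ?thesis using True summand_facts(11)[OF summand_in] idem xy by simp
next
  case False
  then have sxy: "s x \<noteq> s y" using lev_sign_inj xy by metis
  have s: "s x \<noteq> 0" "s y \<noteq> 0"
    using sign_zero_iff[OF xy(1)] sign_zero_iff[OF xy(2)] lev_one xy(3-5) by auto
  have "s x \<in> signs i" "s y \<in> signs i" using xy(1-4) by (auto simp: signs_def)
  then have ms: "signs i \<noteq> {-1}" "signs i \<noteq> {1}" using sxy by auto
  have two: "{u, v} = {x, y}" if uv: "u \<in> carrier M" "v \<in> carrier M" "lev u = i" "lev v = i" "u \<noteq> v" for u v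
  proof -
    have ne: "z \<noteq> \<one>" if "lev z = i" for z using that xy(5) lev_one by auto
    have "s u \<noteq> s v" using lev_sign_inj uv by metis
    then have "s u = s x \<and> s v = s y \<or> s u = s y \<and> s v = s x"
      using sign_cases[OF xy(1) ne[OF xy(3)]] sign_cases[OF xy(2) ne[OF xy(4)]]
        sign_cases[OF uv(1) ne[OF uv(3)]] sign_cases[OF uv(2) ne[OF uv(4)]] sxy by auto
    then show ?thesis
      using lev_sign_inj[OF uv(1) xy(1)] lev_sign_inj[OF uv(2) xy(2)]
        lev_sign_inj[OF uv(1) xy(2)] lev_sign_inj[OF uv(2) xy(1)] uv(3,4) xy(3,4) by auto
  qed
  show ?thesis
  proof (cases "x \<otimes> y = x")
    case True
    then have "summand i = G3" using xy False ms by (auto simp: summand_def)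
    then show ?thesis using True s by (simp add: G3_def)
  next
    case nx: False
    then have p: "x \<otimes> y = y" "y \<otimes> x = x" using mult_same[of x y] xy False by auto
    have no: "\<not> (\<exists>u\<in>carrier M. \<exists>v\<in>carrier M. lev u = i \<and> lev v = i \<and> u \<noteq> v \<and> u \<otimes> v = u)"
    proof clarify
      fix u v assume uv: "u \<in> carrier M" "v \<in> carrier M" "i = lev u" "lev v = lev u" "u \<noteq> v" "u \<otimes> v = u"
      then have "u = x \<and> v = y \<or> u = y \<and> v = x" using two[of u v] by (auto simp: doubleton_eq_iff)
      then show False using uv p False by auto
    qed
    have "summand i = D3"
      unfolding summand_def if_not_P[OF ms(1)] if_not_P[OF ms(2)] if_not_P[OF no] ..
    then show ?thesis using p s by (simp add: D3_def)
  qed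
qed

text \<open>The isomorphism sends an element other than \<open>e\<close> to its level, as tag, and its sign.\<close>

lemma isomorphic_nested_sum: "lm_isomorphic M (big_nested_sum n summand)"
proof -
  let ?B = "big_nested_sum n summand"
  define h where "h x = (if x = \<one> then None else Some (lev x, s x))" for x
  have B: "carrier ?B = insert None {Some (i, z) | i z. i \<in> {1..n} \<and> z \<in> carrier (summand i) - {0}}"
    "\<one>\<^bsub>?B\<^esub> = None"
    and Bop: "\<And>a b. \<lbrakk>a \<in> carrier ?B; b \<in> carrier ?B\<rbrakk> \<Longrightarrow> a \<otimes>\<^bsub>?B\<^esub> b = nested_mult summand a b"
      "\<And>a b. \<lbrakk>a \<in> carrier ?B; b \<in> carrier ?B\<rbrakk> \<Longrightarrow>
        a \<curlywedge>\<^bsub>?B\<^esub> b = (if nested_height n a \<le> nested_height n b then a else b)"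
      "\<And>a b. \<lbrakk>a \<in> carrier ?B; b \<in> carrier ?B\<rbrakk> \<Longrightarrow>
        a \<curlyvee>\<^bsub>?B\<^esub> b = (if nested_height n a \<le> nested_height n b then b else a)"
    using big_nested_sum_description[of n summand n] summand_in by simp_all
  have lb: "lev x \<in> {1..n}" if "x \<in> carrier M" "x \<noteq> \<one>" for x
    using that lev_bounds lev_less by simp
  have hB: "h x \<in> carrier ?B" if x: "x \<in> carrier M" for x
  proof (cases "x = \<one>")
    case False
    have "s x \<in> signs (lev x)" using x by (auto simp: signs_def)
    then have "s x \<in> carrier (summand (lev x)) - {0}" using carrier_summand[OF lb[OF x False]] by simp
    then show ?thesis using False lb[OF x False] by (simp add: B h_def)
  qed (simp add: B h_def)
  have img: "h ` carrier M = carrier ?B"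
  proof
    show "h ` carrier M \<subseteq> carrier ?B" using hB by blast
    show "carrier ?B \<subseteq> h ` carrier M"
    proof
      fix b assume "b \<in> carrier ?B"
      then have "b = None \<or> (\<exists>i z. b = Some (i, z) \<and> i \<in> {1..n} \<and> z \<in> carrier (summand i) - {0})"
        unfolding B(1) by blast
      then consider "b = None" | i z where "b = Some (i, z)" "i \<in> {1..n}" "z \<in> signs i"
        using carrier_summand by metis
      then show "b \<in> h ` carrier M"
      proof cases
        case 1 then show ?thesis by (force simp: h_def)
      next
        case 2
        then obtain x where "x \<in> carrier M" "lev x = i" "s x = z" by (auto simp: signs_def)
        moreover from this have "x \<noteq> \<one>" using 2 lev_one by auto
        ultimately show ?thesis using 2 by (force simp: h_def)
      qed
    qed
  qed
  have inj: "inj_on h (carrier M)"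
    by (rule inj_onI) (auto simp: h_def lev_sign_inj split: if_splits)
  have ht: "nested_height n (h x) = height n (lev x) (s x)" for x
    by (simp add: nested_height_def h_def height_def sign_one)
  have hm: "h (x \<otimes> y) = nested_mult summand (h x) (h y)" if xy: "x \<in> carrier M" "y \<in> carrier M" for x y
  proof -
    consider "x = \<one>" | "y = \<one>" | "x \<noteq> \<one>" "y \<noteq> \<one>" "lev x < lev y"
      | "x \<noteq> \<one>" "y \<noteq> \<one>" "lev y < lev x" | "x \<noteq> \<one>" "y \<noteq> \<one>" "lev y = lev x" by linarith
    then show ?thesis
    proof cases
      case 3 then show ?thesis using mult_outer[OF xy] by (simp add: h_def nested_mult_def)
    next
      case 4 then show ?thesis using mult_outer[OF xy(2,1)] by (simp add: h_def nested_mult_def)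
    next
      case 5
      then have l: "lev (x \<otimes> y) = lev x" using mult_lev[OF xy] by simp
      then have "x \<otimes> y \<noteq> \<one>" using lb[OF xy(1) 5(1)] lev_one by auto
      then show ?thesis using 5 l mult_summand[OF xy refl 5(3) lb[OF xy(1) 5(1)]]
        by (simp add: h_def nested_mult_def)
    qed (auto simp: h_def nested_mult_def xy split: option.split)
  qed
  have "h \<in> lm_iso M ?B"
    unfolding lm_iso_def lm_hom_def hom_def bij_betw_def mem_Collect_eq
  proof (intro conjI ballI funcsetI)
    show "h \<one> = \<one>\<^bsub>?B\<^esub>" by (simp add: h_def B(2))
    fix x y assume xy: "x \<in> carrier M" "y \<in> carrier M"
    note op = Bop[OF hB[OF xy(1)] hB[OF xy(2)]]
    show "h (x \<otimes> y) = h x \<otimes>\<^bsub>?B\<^esub> h y" using hm[OF xy] op(1) by simp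
    show "h (x \<curlywedge> y) = h x \<curlywedge>\<^bsub>?B\<^esub> h y" using op(2) by (simp add: ht meet_height[OF xy])
    show "h (x \<curlyvee> y) = h x \<curlyvee>\<^bsub>?B\<^esub> h y" using op(3) by (simp add: ht join_height[OF xy])
  qed (use hB inj img in auto)
  then show ?thesis by (auto simp: lm_isomorphic_def)
qed

lemma alternating_iff_summands:
  assumes Ms: "\<And>i. i \<in> {1..n} \<Longrightarrow> Ms i \<in> {C2, C2d, G3, D3} \<and> carrier (Ms i) - {0} = signs i"
  shows "alternating \<longleftrightarrow> (\<forall>i\<in>{1..n - 1}. Ms i = Ms (i + 1) \<longrightarrow> Ms i \<in> {G3, D3})"
  unfolding alternating_def
proof (rule ball_cong[OF refl])
  fix i assume "i \<in> {1..n - 1}"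
  then have "i \<in> {1..n}" "i + 1 \<in> {1..n}" by auto
  from Ms[OF this(1)] Ms[OF this(2)] alternating_summands[of "Ms i" "Ms (i + 1)"]
  show "(signs i = signs (i + 1) \<longrightarrow> signs i = {-1, 1}) \<longleftrightarrow>
      (Ms i = Ms (i + 1) \<longrightarrow> Ms i \<in> {G3, D3})" by simp
qed

end

section \<open>Subdirectly irreducible algebras and their congruences\<close>

theorem theorem4p3:
  fixes M :: "'a lmonoid"
  assumes "distributive_lmonoid M"
    and "idempotent_lm M"
    and "semilinear M"
    and "finite (carrier M)"
    and "carrier M \<noteq> {\<one>\<^bsub>M\<^esub>}"
  shows "(subdirectly_irreducible M \<longleftrightarrow>
      (\<exists>(n::nat) (Ms :: nat \<Rightarrow> int lmonoid).
         n \<noteq> 0 \<and>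
         (\<forall>i\<in>{1..n}. Ms i \<in> {C2, C2d, G3, D3}) \<and>
         (\<forall>i\<in>{1..n - 1}. Ms i = Ms (i + 1) \<longrightarrow> Ms i \<in> {G3, D3}) \<and>
         lm_isomorphic M (big_nested_sum n Ms)))
    \<and> (subdirectly_irreducible M \<longleftrightarrow> chain\<^sub>\<subseteq> (congruences M))"
proof -
  interpret distributive_lmonoid M by fact
  let ?nested = "\<exists>(n::nat) (Ms :: nat \<Rightarrow> int lmonoid).
         n \<noteq> 0 \<and>
         (\<forall>i\<in>{1..n}. Ms i \<in> {C2, C2d, G3, D3}) \<and>
         (\<forall>i\<in>{1..n - 1}. Ms i = Ms (i + 1) \<longrightarrow> Ms i \<in> {G3, D3}) \<and>
         lm_isomorphic M (big_nested_sum n Ms)"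
  have si_nested: ?nested if si: "subdirectly_irreducible M"
  proof -
    have "ordered_monoid M"
      using subdirectly_irreducible_semilinear_total[OF si assms(3,4)] .
    then interpret idempotent_chain M
      using assms(2) by unfold_locales (simp_all add: ordered_monoid_def idempotent_lm_def)
    obtain n lev s where "layered_lmonoid M n lev s" using finite_imp_layered[OF assms(4)] .
    then interpret L: layered_lmonoid M n lev s .
    obtain x where "x \<in> carrier M" "x \<noteq> \<one>\<^bsub>M\<^esub>" using assms(5) one_closed by blast
    then have "n \<noteq> 0" using L.lev_bounds L.lev_less by fastforce
    moreover have "\<forall>i\<in>{1..n - 1}. L.summand i = L.summand (i + 1) \<longrightarrow> L.summand i \<in> {G3, D3}"
      using L.alternating_iff_summands[of L.summand, OF conjI[OF L.summand_in L.carrier_summand]]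
        L.subdirectly_irreducible_imp_alternating[OF si] by (rule iffD1)
    moreover have "\<forall>i\<in>{1..n}. L.summand i \<in> {C2, C2d, G3, D3}" using L.summand_in by blast
    ultimately show ?nested using L.isomorphic_nested_sum by (intro exI conjI)
  qed
  have nested_chain: "chain\<^sub>\<subseteq> (congruences M)" if nested: ?nested
  proof -
    obtain n Ms where Ms: "\<forall>i\<in>{1..n}. Ms i \<in> {C2, C2d, G3, D3}"
      "\<forall>i\<in>{1..n - 1}. Ms i = Ms (i + 1) \<longrightarrow> Ms i \<in> {G3, D3}"
      "lm_isomorphic M (big_nested_sum n Ms)"
      using nested by (elim exE conjE) (rule that)
    obtain lev s where L: "layered_lmonoid M n lev s"
      and signs: "\<And>i. i \<in> {1..n} \<Longrightarrow> s ` {x \<in> carrier M. lev x = i} = carrier (Ms i) - {0}"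
      using isomorphic_nested_sum_imp_layered[OF assms(1,2) Ms(1,3)] by blast
    interpret L: layered_lmonoid M n lev s by (fact L)
    have "L.alternating"
      using L.alternating_iff_summands[of Ms] Ms(1,2) signs by (auto simp: L.signs_def)
    then show ?thesis by (rule L.alternating_imp_chain)
  qed
  have "chain\<^sub>\<subseteq> (congruences M) \<Longrightarrow> subdirectly_irreducible M"
    by (rule chain_congruences_imp_subdirectly_irreducible[OF assms(4,5)])
  with si_nested nested_chain show ?thesis by blast
qed

end
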